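(* $\mathrm{dist}_{qGH^*}$ is a metric on the set of isomorphism classes of Lip-von Neumann algebras; in particular, for Lip-von Neumann algebras $(M,L_M)$, $(N,L_N)$, $\mathrm{dist}_{qGH^*}(M,N)=0$ if and only if $(M,L_M)$ and $(N,L_N)$ are isomorphic as Lip-von Neumann algebras.
   Context: A Lip-von Neumann algebra (LvNA) is a pair $(M,L_M)$ where $M$ is a von Neumann algebra and $L_M$ is a norm on $M$ (everywhere finite) inducing the $w^*$-topology on bounded subsets of $M$ (equivalently, the closed unit ball $M_1=\{x\in M:\|x\|\le 1\}$ is compact in the $L_M$-topology). Two LvNAs $(M,L_M)$, $(N,L_N)$ are isomorphic if there is a ${}^*$-isomorphism $\phi:M\to N$ with $L_N\circ\phi=L_M$. $L_M$ is extended to $\mathcal M_2(M)$ ($2\times2$ matrices over $M$) by $L_M((a_{ij}))=\max_{i,j}L_M(a_{ij})$. For LvNAs $(M,L_M)$, $(N,L_N)$, $\mathcal L(M,N)$ is the set of seminorms $L$ on $M\oplus N$ with $L(x,0)=L_M(x)$ and $L(0,y)=L_N(y)$ for all $x\in M,y\in N$; each such $L$ is extended to $\mathcal M_2(M)\oplus\mathcal M_2(N)\cong\mathcal M_2(M\oplus N)$ by entrywise maximum. $X_M=\{x\in\mathcal M_2(M): x\ge 0,\ \|x\|\le 1\}$, and similarly $X_N$. For $L\in\mathcal L(M,N)$, $\mathrm{dist}^L_H(X_M,X_N)=\max\big(\sup_{x\in X_M}\inf_{y\in X_N}L(x,-y),\ \sup_{y\in X_N}\inf_{x\in X_M}L(x,-y)\big)$,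 and the dual quantum Gromov–Hausdorff distance is $\mathrm{dist}_{qGH^*}(M,N)=\inf_{L\in\mathcal L(M,N)}\mathrm{dist}^L_H(X_M,X_N)$. *)

theory Defs
  imports Complex_Main "HOL-Library.Extended_Real"
begin

class chilbert = ab_group_add +
  fixes hscale :: "complex \<Rightarrow> 'a \<Rightarrow> 'a"
    and cinner :: "'a \<Rightarrow> 'a \<Rightarrow> complex"
  assumes hscale_add_right: "hscale c (x + y) = hscale c x + hscale c y"
    and hscale_add_left: "hscale (a + b) x = hscale a x + hscale b x"
    and hscale_hscale: "hscale a (hscale b x) = hscale (a * b) x"
    and hscale_one: "hscale 1 x = x"
    and cinner_add_left: "cinner (x + y) z = cinner x z + cinner y z"
    and cinner_hscale_left: "cinner (hscale c x) y = cnj c * cinner x y"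
    and cinner_commute: "cinner y x = cnj (cinner x y)"
    and cinner_pos: "0 \<le> Re (cinner x x)"
    and cinner_eq_zero: "cinner x x = 0 \<longleftrightarrow> x = 0"
    and hilbert_complete:
      "(\<forall>e>0. \<exists>N::nat. \<forall>m\<ge>N. \<forall>n\<ge>N. sqrt (Re (cinner (X m - X n) (X m - X n))) < e)
        \<Longrightarrow> (\<exists>l. \<forall>e>0. \<exists>N::nat. \<forall>n\<ge>N. sqrt (Re (cinner (X n - l) (X n - l))) < e)"

definition hnorm :: "'a::chilbert \<Rightarrow> real" where
  "hnorm x = sqrt (Re (cinner x x))"

definition op_zero :: "'a::chilbert \<Rightarrow> 'a" where "op_zero = (\<lambda>_. 0)"
definition op_add :: "('a::chilbert \<Rightarrow> 'a) \<Rightarrow> ('a \<Rightarrow> 'a) \<Rightarrow> 'a \<Rightarrow> 'a" where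
  "op_add S T = (\<lambda>x. S x + T x)"
definition op_neg :: "('a::chilbert \<Rightarrow> 'a) \<Rightarrow> 'a \<Rightarrow> 'a" where
  "op_neg T = (\<lambda>x. - T x)"
definition op_diff :: "('a::chilbert \<Rightarrow> 'a) \<Rightarrow> ('a \<Rightarrow> 'a) \<Rightarrow> 'a \<Rightarrow> 'a" where
  "op_diff S T = (\<lambda>x. S x - T x)"
definition op_scale :: "complex \<Rightarrow> ('a::chilbert \<Rightarrow> 'a) \<Rightarrow> 'a \<Rightarrow> 'a" where
  "op_scale c T = (\<lambda>x. hscale c (T x))"

definition bounded_op :: "('a::chilbert \<Rightarrow> 'a) \<Rightarrow> bool" where
  "bounded_op T \<longleftrightarrow>
     (\<forall>x y. T (x + y) = T x + T y) \<and> (\<forall>c x. T (hscale c x) = hscale c (T x)) \<and>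
     (\<exists>K. \<forall>x. hnorm (T x) \<le> K * hnorm x)"

definition adj :: "('a::chilbert \<Rightarrow> 'a) \<Rightarrow> 'a \<Rightarrow> 'a" where
  "adj T = (SOME S. \<forall>x y. cinner (T x) y = cinner x (S y))"

text \<open>Basic neighbourhoods of the sigma-weak (= w*) topology: for square-summable
sequences xi, eta, the functional x \<mapsto> sum_n <xi_n, x eta_n>.\<close>

definition sq_summable :: "(nat \<Rightarrow> 'a::chilbert) \<Rightarrow> bool" where
  "sq_summable \<xi> \<longleftrightarrow> summable (\<lambda>n. (hnorm (\<xi> n))\<^sup>2)"

definition sw_functional :: "(nat \<Rightarrow> 'a::chilbert) \<Rightarrow> (nat \<Rightarrow> 'a) \<Rightarrow> ('a \<Rightarrow> 'a) \<Rightarrow> complex" where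
  "sw_functional \<xi> \<eta> T = (\<Sum>n. cinner (\<xi> n) (T (\<eta> n)))"

definition von_neumann_algebra :: "('a::chilbert \<Rightarrow> 'a) set \<Rightarrow> bool" where
  "von_neumann_algebra M \<longleftrightarrow>
     (\<forall>T\<in>M. bounded_op T) \<and> id \<in> M \<and>
     (\<forall>S\<in>M. \<forall>T\<in>M. op_add S T \<in> M \<and> S \<circ> T \<in> M) \<and>
     (\<forall>c. \<forall>T\<in>M. op_scale c T \<in> M) \<and> (\<forall>T\<in>M. adj T \<in> M) \<and>
     (\<forall>T. bounded_op T \<longrightarrow>
        (\<forall>n::nat. \<forall>\<xi> \<eta> :: nat \<Rightarrow> 'a. \<forall>e>0. \<exists>S\<in>M.
            \<forall>k<n. cmod (cinner (\<xi> k) (op_diff S T (\<eta> k))) < e) \<longrightarrow> T \<in> M)"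

definition op_bounded_set :: "('a::chilbert \<Rightarrow> 'a) set \<Rightarrow> bool" where
  "op_bounded_set B \<longleftrightarrow> (\<exists>K. \<forall>T\<in>B. \<forall>x. hnorm (T x) \<le> K * hnorm x)"

text \<open>L is a norm on M whose metric topology agrees with the w*-topology on every
bounded subset B of M (relative neighbourhoods agree at each point of B).\<close>

definition LvNA :: "('a::chilbert \<Rightarrow> 'a) set \<Rightarrow> (('a \<Rightarrow> 'a) \<Rightarrow> real) \<Rightarrow> bool" where
  "LvNA M L \<longleftrightarrow> von_neumann_algebra M \<and>
     (\<forall>x\<in>M. 0 \<le> L x) \<and> (\<forall>x\<in>M. L x = 0 \<longleftrightarrow> x = op_zero) \<and>
     (\<forall>c. \<forall>x\<in>M. L (op_scale c x) = cmod c * L x) \<and>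
     (\<forall>x\<in>M. \<forall>y\<in>M. L (op_add x y) \<le> L x + L y) \<and>
     (\<forall>B. B \<subseteq> M \<longrightarrow> op_bounded_set B \<longrightarrow> (\<forall>x\<in>B. \<forall>U.
        (\<exists>e>0. \<forall>y\<in>B. L (op_diff y x) < e \<longrightarrow> y \<in> U) \<longleftrightarrow>
        (\<exists>(m::nat) (\<xi>::nat \<Rightarrow> nat \<Rightarrow> 'a) \<eta> e. e > 0 \<and>
           (\<forall>k<m. sq_summable (\<xi> k) \<and> sq_summable (\<eta> k)) \<and>
           (\<forall>y\<in>B. (\<forall>k<m. cmod (sw_functional (\<xi> k) (\<eta> k) (op_diff y x)) < e) \<longrightarrow> y \<in> U))))"

definition LvNA_iso :: "('a::chilbert \<Rightarrow> 'a) set \<Rightarrow> (('a \<Rightarrow> 'a) \<Rightarrow> real)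
    \<Rightarrow> ('b::chilbert \<Rightarrow> 'b) set \<Rightarrow> (('b \<Rightarrow> 'b) \<Rightarrow> real) \<Rightarrow> bool" where
  "LvNA_iso M LM N LN \<longleftrightarrow> (\<exists>\<phi>. bij_betw \<phi> M N \<and>
     (\<forall>x\<in>M. \<forall>y\<in>M. \<phi> (op_add x y) = op_add (\<phi> x) (\<phi> y) \<and> \<phi> (x \<circ> y) = \<phi> x \<circ> \<phi> y) \<and>
     (\<forall>c. \<forall>x\<in>M. \<phi> (op_scale c x) = op_scale c (\<phi> x)) \<and>
     (\<forall>x\<in>M. \<phi> (adj x) = adj (\<phi> x)) \<and>
     (\<forall>x\<in>M. LN (\<phi> x) = LM x))"

type_synonym 'a mat2 = "bool \<Rightarrow> bool \<Rightarrow> 'a \<Rightarrow> 'a"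

definition mat2_apply :: "'a::chilbert mat2 \<Rightarrow> (bool \<Rightarrow> 'a) \<Rightarrow> bool \<Rightarrow> 'a" where
  "mat2_apply A v = (\<lambda>i. A i False (v False) + A i True (v True))"

definition X_set :: "('a::chilbert \<Rightarrow> 'a) set \<Rightarrow> 'a mat2 set" where
  "X_set M = {A. (\<forall>i j. A i j \<in> M) \<and>
     (\<forall>v. let z = cinner (v False) (mat2_apply A v False) + cinner (v True) (mat2_apply A v True)
          in Im z = 0 \<and> 0 \<le> Re z) \<and>
     (\<forall>v. (hnorm (mat2_apply A v False))\<^sup>2 + (hnorm (mat2_apply A v True))\<^sup>2
          \<le> (hnorm (v False))\<^sup>2 + (hnorm (v True))\<^sup>2)}"

definition admissible :: "('a::chilbert \<Rightarrow> 'a) set \<Rightarrow> (('a \<Rightarrow> 'a) \<Rightarrow> real)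
    \<Rightarrow> ('b::chilbert \<Rightarrow> 'b) set \<Rightarrow> (('b \<Rightarrow> 'b) \<Rightarrow> real)
    \<Rightarrow> (('a \<Rightarrow> 'a) \<times> ('b \<Rightarrow> 'b) \<Rightarrow> real) set" where
  "admissible M LM N LN = {L.
     (\<forall>p\<in>M \<times> N. 0 \<le> L p) \<and>
     (\<forall>c. \<forall>(x, y)\<in>M \<times> N. L (op_scale c x, op_scale c y) = cmod c * L (x, y)) \<and>
     (\<forall>(x, y)\<in>M \<times> N. \<forall>(x', y')\<in>M \<times> N.
         L (op_add x x', op_add y y') \<le> L (x, y) + L (x', y')) \<and>
     (\<forall>x\<in>M. L (x, op_zero) = LM x) \<and> (\<forall>y\<in>N. L (op_zero, y) = LN y)}"

definition L_mat2 :: "(('a::chilbert \<Rightarrow> 'a) \<times> ('b::chilbert \<Rightarrow> 'b) \<Rightarrow> real)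
    \<Rightarrow> 'a mat2 \<Rightarrow> 'b mat2 \<Rightarrow> real" where
  "L_mat2 L A B = Max ((\<lambda>(i, j). L (A i j, B i j)) ` UNIV)"

definition dist_H :: "(('a::chilbert \<Rightarrow> 'a) \<times> ('b::chilbert \<Rightarrow> 'b) \<Rightarrow> real)
    \<Rightarrow> ('a \<Rightarrow> 'a) set \<Rightarrow> ('b \<Rightarrow> 'b) set \<Rightarrow> ereal" where
  "dist_H L M N = max
     (SUP A\<in>X_set M. INF B\<in>X_set N. ereal (L_mat2 L A (\<lambda>i j. op_neg (B i j))))
     (SUP B\<in>X_set N. INF A\<in>X_set M. ereal (L_mat2 L A (\<lambda>i j. op_neg (B i j))))"

definition dist_qGH :: "('a::chilbert \<Rightarrow> 'a) set \<Rightarrow> (('a \<Rightarrow> 'a) \<Rightarrow> real)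
    \<Rightarrow> ('b::chilbert \<Rightarrow> 'b) set \<Rightarrow> (('b \<Rightarrow> 'b) \<Rightarrow> real) \<Rightarrow> ereal" where
  "dist_qGH M LM N LN = (INF L\<in>admissible M LM N LN. dist_H L M N)"

end

theory Submission
  imports Defs "HOL-Analysis.Uniform_Limit"
begin

text \<open>If the distance vanishes, pick seminorms \<open>L\<^sub>n\<close> realising it up to \<open>1/(n+1)\<close> and a free
  ultrafilter \<open>U\<close> on the natural numbers, and relate \<open>x\<close> to \<open>y\<close> when \<open>L\<^sub>n (x, -y)\<close> tends to \<open>0\<close> along \<open>U\<close>.
  Weak ultralimits of bounded sequences exist (Riesz), lie in the algebra, and are limits for its norm, so
  this relation is the graph of a linear isometry that maps positive contractions of the two-by-two
  matrices onto positive contractions. Such a map is unital and adjoint-preserving, and the Schwarz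
  inequality for it and for its inverse makes it multiplicative. Conversely, a star isomorphism preserves
  positive contractions of matrices because it preserves resolvents.\<close>

subsection \<open>Hilbert space preliminaries\<close>

text \<open>Positive contractions of \<open>M\<close> alone would recover too little: the transpose
  of a matrix algebra is a unital order isomorphism that reverses products. Matrices of size two
  remove this ambiguity, because the Gram matrix \<open>mat22 id x (adj x) (adj x \<circ> x)\<close>
  is positive and its image compares the image of \<open>adj x \<circ> x\<close> with
  \<open>adj y \<circ> y\<close>; polarization then passes from these squares to all products. They
  also carry arbitrary elements, as off-diagonal corners of positive matrices, so a relation known
  only on positive contractions reaches the whole algebra.

  No single seminorm need attain the infimum, and the partners of a given \<open>x\<close> vary with
  \<open>n\<close>. The ultrafilter decides the limits of all matrix coefficients at once, where a
  diagonal subsequence would call for separability.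

  The triangle inequality comes from an infimal convolution of two seminorms over the middle
  algebra; they agree there, which keeps the glued seminorm equal to the given norms at both ends.
  Finiteness holds because a norm compatible with the w*-topology is bounded on the unit
  ball.\<close>

lemma hscale_zero_right [simp]: "hscale c (0::'a::chilbert) = 0"
  using hscale_add_right[of c 0 "0::'a"] by simp

lemma hscale_zero_left [simp]: "hscale 0 (x::'a::chilbert) = 0"
  using hscale_add_left[of 0 0 x] by simp

lemma hscale_minus_right: "hscale c (- x) = - hscale c (x::'a::chilbert)"
  using hscale_add_right[of c x "-x"] by (simp add: eq_neg_iff_add_eq_0 add.commute)

lemma hscale_minus_left: "hscale (- c) x = - hscale c (x::'a::chilbert)"
  using hscale_add_left[of c "-c" x] by (simp add: eq_neg_iff_add_eq_0 add.commute)

lemma hscale_minus_one: "hscale (- 1) x = - (x::'a::chilbert)"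
  by (simp add: hscale_minus_left hscale_one)

lemma hscale_diff_right: "hscale c (x - y) = hscale c x - hscale c (y::'a::chilbert)"
  using hscale_add_right[of c x "-y"] by (simp add: hscale_minus_right)

lemma cinner_add_right: "cinner z (x + y) = cinner z x + cinner z (y::'a::chilbert)"
  by (metis cinner_add_left cinner_commute complex_cnj_add)

lemma cinner_hscale_right: "cinner y (hscale c x) = c * cinner y (x::'a::chilbert)"
  by (metis cinner_commute cinner_hscale_left complex_cnj_cnj complex_cnj_mult)

lemma cinner_zero_right [simp]: "cinner x (0::'a::chilbert) = 0"
  using cinner_add_right[of x 0 0] by simp

lemma cinner_zero_left [simp]: "cinner (0::'a::chilbert) x = 0"
  using cinner_add_left[of 0 0 x] by simp

lemma cinner_minus_right: "cinner x (- y) = - cinner x (y::'a::chilbert)"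
  using cinner_add_right[of x y "-y"] by (simp add: eq_neg_iff_add_eq_0 add.commute)

lemma cinner_minus_left: "cinner (- x) y = - cinner x (y::'a::chilbert)"
  using cinner_add_left[of x "-x" y] by (simp add: eq_neg_iff_add_eq_0 add.commute)

lemma cinner_diff_right: "cinner x (y - z) = cinner x y - cinner x (z::'a::chilbert)"
  using cinner_add_right[of x y "-z"] by (simp add: cinner_minus_right)

lemma cinner_diff_left: "cinner (x - y) z = cinner x z - cinner y (z::'a::chilbert)"
  using cinner_add_left[of x "-y" z] by (simp add: cinner_minus_left)

lemmas cinner_simps = cinner_add_left cinner_add_right cinner_diff_left cinner_diff_right
  cinner_minus_left cinner_minus_right cinner_hscale_left cinner_hscale_right

lemma Im_cinner_same [simp]: "Im (cinner x (x::'a::chilbert)) = 0"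
proof -
  have "cinner x x = cnj (cinner x x)" by (rule cinner_commute)
  then have "Im (cinner x x) = Im (cnj (cinner x x))" by (rule arg_cong)
  then show ?thesis by simp
qed

lemma hnorm_nonneg [simp]: "0 \<le> hnorm (x::'a::chilbert)"
  by (simp add: hnorm_def cinner_pos)

lemma hnorm_sq: "(hnorm x)\<^sup>2 = Re (cinner x (x::'a::chilbert))"
  by (simp add: hnorm_def cinner_pos)

lemma cinner_same: "cinner x x = complex_of_real ((hnorm x)\<^sup>2)" for x :: "'a::chilbert"
  by (simp add: complex_eq_iff hnorm_sq)

lemma hnorm_eq_0 [simp]: "hnorm x = 0 \<longleftrightarrow> x = (0::'a::chilbert)"
  using cinner_eq_zero[of x] by (simp add: cinner_same)

lemma hnorm_zero [simp]: "hnorm (0::'a::chilbert) = 0"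
  by simp

lemma hnorm_hscale: "hnorm (hscale c x) = cmod c * hnorm (x::'a::chilbert)"
proof -
  have "cinner (hscale c x) (hscale c x) = (cnj c * c) * cinner x x"
    by (simp add: cinner_simps)
  also have "cnj c * c = complex_of_real ((cmod c)\<^sup>2)"
    by (simp only: complex_norm_square mult.commute)
  finally have "(hnorm (hscale c x))\<^sup>2 = (cmod c * hnorm x)\<^sup>2"
    by (simp only: cinner_same power_mult_distrib of_real_mult[symmetric] of_real_eq_iff)
  then show ?thesis
    by (metis hnorm_nonneg norm_ge_zero mult_nonneg_nonneg power2_eq_iff_nonneg)
qed

lemma hnorm_minus [simp]: "hnorm (- x) = hnorm (x::'a::chilbert)"
  by (simp add: hnorm_def cinner_simps)

lemma cinner_ext_right: "(\<And>v. cinner v x = cinner v y) \<Longrightarrow> x = (y::'a::chilbert)"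
proof -
  assume a: "\<And>v. cinner v x = cinner v y"
  have "cinner (x - y) (x - y) = 0" by (simp add: cinner_diff_right a)
  then show ?thesis by (simp add: cinner_eq_zero)
qed

lemma parallelogram:
  "(hnorm (x + y))\<^sup>2 + (hnorm (x - y))\<^sup>2 = 2 * (hnorm x)\<^sup>2 + 2 * (hnorm (y::'a::chilbert))\<^sup>2"
  by (simp add: hnorm_sq cinner_simps)

text \<open>Semidefinite forms are allowed, so that the result covers both the inner product and the
  form \<open>cinner x (T y)\<close> of a positive operator. Expanding \<open>q\<close> at
  \<open>t c x + y\<close> with \<open>c = q x y\<close> leaves a real quadratic in \<open>t\<close>
  that is never negative.\<close>

lemma positive_form_Cauchy_Schwarz:
  fixes q :: "'a::chilbert \<Rightarrow> 'a \<Rightarrow> complex"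
  assumes addl: "\<And>x y z. q (x + y) z = q x z + q y z"
    and addr: "\<And>x y z. q z (x + y) = q z x + q z y"
    and scl: "\<And>c x y. q (hscale c x) y = cnj c * q x y"
    and scr: "\<And>c x y. q x (hscale c y) = c * q x y"
    and her: "\<And>x y. q y x = cnj (q x y)"
    and pos: "\<And>x. 0 \<le> Re (q x x)"
  shows "(cmod (q x y))\<^sup>2 \<le> Re (q x x) * Re (q y y)"
proof -
  define c where "c = q x y"
  have yx: "q y x = cnj c" unfolding c_def by (rule her)
  have key: "0 \<le> t\<^sup>2 * (cmod c)\<^sup>2 * Re (q x x) + 2 * t * (cmod c)\<^sup>2 + Re (q y y)" for t :: real
  proof -
    have "0 \<le> Re (q (hscale (of_real t * c) x + y) (hscale (of_real t * c) x + y))"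
      by (rule pos)
    also have "q (hscale (of_real t * c) x + y) (hscale (of_real t * c) x + y)
        = of_real (t\<^sup>2) * (c * cnj c) * q x x + 2 * of_real t * (c * cnj c) + q y y"
      by (simp add: addl addr scl scr yx c_def[symmetric] algebra_simps power2_eq_square)
    also have "c * cnj c = of_real ((cmod c)\<^sup>2)" by (simp only: complex_norm_square)
    finally show ?thesis by (simp flip: of_real_mult of_real_power)
  qed
  show ?thesis
  proof (cases "c = 0")
    case True
    then show ?thesis using pos by (simp add: c_def[symmetric])
  next
    case False
    then have c2: "(cmod c)\<^sup>2 > 0" by simp
    show ?thesis
    proof (cases "Re (q x x) = 0")
      case True
      \<comment> \<open>Without a quadratic term the expression is affine in \<open>t\<close>, and
        this \<open>t\<close> makes it equal to -1.\<close>
      have "0 \<le> 2 * (- (Re (q y y) + 1) / (2 * (cmod c)\<^sup>2)) * (cmod c)\<^sup>2 + Re (q y y)"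
        using key[of "- (Re (q y y) + 1) / (2 * (cmod c)\<^sup>2)"] True by simp
      then show ?thesis using c2 by (simp add: field_simps)
    next
      case False
      define a where "a = Re (q x x)"
      have a: "a > 0" using False pos[of x] unfolding a_def by simp
      \<comment> \<open>\<open>- 1 / a\<close> minimises the quadratic.\<close>
      have "0 \<le> (- 1 / a)\<^sup>2 * (cmod c)\<^sup>2 * a + 2 * (- 1 / a) * (cmod c)\<^sup>2 + Re (q y y)"
        using key[of "- 1 / a"] by (simp add: a_def)
      also have "(- 1 / a)\<^sup>2 * (cmod c)\<^sup>2 * a + 2 * (- 1 / a) * (cmod c)\<^sup>2 = - (cmod c)\<^sup>2 / a"
        using a by (simp add: field_simps power2_eq_square)
      finally show ?thesis using a by (simp add: a_def[symmetric] c_def[symmetric] field_simps)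
    qed
  qed
qed

lemma Cauchy_Schwarz: "cmod (cinner x y) \<le> hnorm x * hnorm (y::'a::chilbert)"
proof -
  have "(cmod (cinner x y))\<^sup>2 \<le> Re (cinner x x) * Re (cinner y y)"
    by (rule positive_form_Cauchy_Schwarz) (simp_all add: cinner_simps cinner_pos cinner_commute[symmetric])
  then have "(cmod (cinner x y))\<^sup>2 \<le> (hnorm x * hnorm y)\<^sup>2"
    by (simp add: hnorm_sq[symmetric] power_mult_distrib)
  then show ?thesis by (rule power2_le_imp_le) simp
qed

lemma hnorm_triangle: "hnorm (x + y) \<le> hnorm x + hnorm (y::'a::chilbert)"
proof (rule power2_le_imp_le)
  have "Re (cinner x y) \<le> hnorm x * hnorm y"
    using Cauchy_Schwarz[of x y] complex_Re_le_cmod order_trans by blast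
  moreover have "Re (cinner y x) = Re (cinner x y)"
    by (metis cinner_commute cnj.sel(1))
  ultimately show "(hnorm (x + y))\<^sup>2 \<le> (hnorm x + hnorm y)\<^sup>2"
    by (simp add: hnorm_sq cinner_simps power2_sum)
qed simp

lemma hilbert_Cauchy_convergent:
  fixes X :: "nat \<Rightarrow> 'a::chilbert"
  assumes "\<And>e. e > 0 \<Longrightarrow> \<exists>N. \<forall>m\<ge>N. \<forall>n\<ge>N. hnorm (X m - X n) < e"
  obtains l where "(\<lambda>n. hnorm (X n - l)) \<longlonglongrightarrow> 0"
proof -
  have "\<exists>l. \<forall>e>0. \<exists>N. \<forall>n\<ge>N. hnorm (X n - l) < e"
    unfolding hnorm_def
    by (rule hilbert_complete) (use assms in \<open>simp add: hnorm_def\<close>)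
  then show ?thesis using that by (fastforce simp: LIMSEQ_iff)
qed

subsection \<open>Riesz representation and adjoints\<close>

text \<open>The representing vector minimises \<open>\<parallel>x\<parallel>\<^sup>2 - 2 Re (f x)\<close>; a minimising sequence is
  Cauchy by the parallelogram law.\<close>

lemma Riesz_representation:
  fixes f :: "'a::chilbert \<Rightarrow> complex"
  assumes add: "\<And>x y. f (x + y) = f x + f y"
    and sc: "\<And>c x. f (hscale c x) = c * f x"
    and bd: "\<And>x. cmod (f x) \<le> K * hnorm x"
  obtains z where "\<And>x. f x = cinner z x" "hnorm z \<le> \<bar>K\<bar>"
proof -
  define J where "J x = (hnorm x)\<^sup>2 - 2 * Re (f x)" for x
  have f_minus: "f (- x) = - f x" for x
    using sc[of "-1" x] by (simp add: hscale_minus_one)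
  have f_diff: "f (x - y) = f x - f y" for x y
    using add[of x "-y"] by (simp add: f_minus)
  have lower: "- (K\<^sup>2) \<le> J x" for x
  proof -
    have "Re (f x) \<le> K * hnorm x"
      using bd[of x] complex_Re_le_cmod[of "f x"] by linarith
    moreover have "0 \<le> (hnorm x - K)\<^sup>2" by simp
    ultimately show ?thesis unfolding J_def by (simp add: power2_diff mult.commute[of K])
  qed
  have bdd: "bdd_below (range J)" by (rule bdd_belowI2) (rule lower)
  define m where "m = (INF x. J x)"
  have m_le: "m \<le> J x" for x unfolding m_def by (rule cINF_lower[OF bdd]) simp
  have par: "(hnorm (x - y))\<^sup>2 = 2 * J x + 2 * J y - 4 * J (hscale (1/2) (x + y))" for x y
  proof -
    have "4 * (hnorm (hscale (1/2) (x + y)))\<^sup>2 = (hnorm (x + y))\<^sup>2"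
      by (simp add: hnorm_hscale power_mult_distrib power2_eq_square)
    moreover have "4 * Re (f (hscale (1/2) (x + y))) = 2 * Re (f x) + 2 * Re (f y)"
      by (simp add: sc add)
    ultimately show ?thesis using parallelogram[of x y] unfolding J_def by (simp add: algebra_simps)
  qed
  have "\<exists>x. J x < m + inverse (real (Suc n))" for n
  proof (rule ccontr)
    assume "\<not> ?thesis"
    then have "m + inverse (real (Suc n)) \<le> J x" for x by (meson not_less)
    then have "m + inverse (real (Suc n)) \<le> m" unfolding m_def by (intro cINF_greatest) auto
    moreover have "inverse (real (Suc n)) > 0" by simp
    ultimately show False by linarith
  qed
  then obtain X where X: "J (X n) < m + inverse (real (Suc n))" for n by metis
  have close: "(hnorm (X i - X n))\<^sup>2 < 4 * inverse (real (Suc k))" if "k \<le> i" "k \<le> n" for i n k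
  proof -
    have "J (X j) < m + inverse (real (Suc k))" if "k \<le> j" for j
    proof -
      have "inverse (real (Suc j)) \<le> inverse (real (Suc k))" using that by (intro le_imp_inverse_le) auto
      then show ?thesis using X[of j] by linarith
    qed
    from this[OF that(1)] this[OF that(2)] show ?thesis
      using m_le[of "hscale (1/2) (X i + X n)"] par[of "X i" "X n"] by linarith
  qed
  have cauchy: "\<exists>N. \<forall>m\<ge>N. \<forall>n\<ge>N. hnorm (X m - X n) < e" if "e > 0" for e
  proof -
    obtain k where k: "inverse (real (Suc k)) < e\<^sup>2 / 4"
      using reals_Archimedean[of "e\<^sup>2 / 4"] \<open>e > 0\<close> by (meson divide_pos_pos zero_less_numeral zero_less_power)
    have "hnorm (X i - X n) < e" if "k \<le> i" "k \<le> n" for i n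
    proof (rule power2_less_imp_less)
      show "(hnorm (X i - X n))\<^sup>2 < e\<^sup>2" using close[OF that] k by simp
    qed (use \<open>e > 0\<close> in simp)
    then show ?thesis by blast
  qed
  from hilbert_Cauchy_convergent[of X, OF cauchy]
  obtain z where z: "(\<lambda>n. hnorm (X n - z)) \<longlonglongrightarrow> 0" by blast
  have Jz: "J z \<le> m"
  proof (rule LIMSEQ_le_const)
    \<comment> \<open>This majorant of \<open>J z\<close> comes from expanding \<open>J\<close> at
      \<open>X n = z + d\<close>; it tends to \<open>m\<close>, so \<open>z\<close> is a
      minimiser.\<close>
    have "(\<lambda>n. m + inverse (real (Suc n)) + (hnorm (X n - z))\<^sup>2
          + 2 * (hnorm (X n - z) * hnorm z + K * hnorm (X n - z)) + (hnorm (X n - z))\<^sup>2)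
          \<longlonglongrightarrow> m + 0 + 0\<^sup>2 + 2 * (0 * hnorm z + K * 0) + 0\<^sup>2"
      by (intro tendsto_intros z LIMSEQ_inverse_real_of_nat)
    then show "(\<lambda>n. m + inverse (real (Suc n)) + (hnorm (X n - z))\<^sup>2
          + 2 * (hnorm (X n - z) * hnorm z + K * hnorm (X n - z)) + (hnorm (X n - z))\<^sup>2) \<longlonglongrightarrow> m" by simp
    have "J z \<le> m + inverse (real (Suc n)) + (hnorm (X n - z))\<^sup>2
          + 2 * (hnorm (X n - z) * hnorm z + K * hnorm (X n - z)) + (hnorm (X n - z))\<^sup>2" for n
    proof -
      define d where "d = X n - z"
      have "J (z + d) = J z + (hnorm d)\<^sup>2 + 2 * (Re (cinner d z) - Re (f d))"
      proof -
        have "Re (cinner z d) = Re (cinner d z)" by (metis cinner_commute cnj.sel(1))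
        then show ?thesis unfolding J_def by (simp add: hnorm_sq cinner_simps add)
      qed
      moreover have "- Re (cinner d z) \<le> hnorm d * hnorm z"
        using Cauchy_Schwarz[of d z] abs_Re_le_cmod[of "cinner d z"] by linarith
      moreover have "Re (f d) \<le> K * hnorm d"
        using bd[of d] complex_Re_le_cmod[of "f d"] by linarith
      moreover have "J (z + d) < m + inverse (real (Suc n))" using X[of n] by (simp add: d_def)
      ultimately show ?thesis unfolding d_def[symmetric]
        by (smt (verit) zero_le_power2)
    qed
    then show "\<exists>N. \<forall>n\<ge>N. J z \<le> m + inverse (real (Suc n)) + (hnorm (X n - z))\<^sup>2
          + 2 * (hnorm (X n - z) * hnorm z + K * hnorm (X n - z)) + (hnorm (X n - z))\<^sup>2" by blast
  qed
  have eq: "f x = cinner z x" for x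
  proof -
    \<comment> \<open>\<open>g\<close> is the error of the representation at \<open>x\<close>.
      Moving \<open>z\<close> along \<open>cnj g\<close> times \<open>x\<close> changes
      \<open>J\<close> to first order by \<open>2 * t * (cmod g)\<^sup>2\<close>, which takes both
      signs unless \<open>g = 0\<close>.\<close>
    define g where "g = cinner z x - f x"
    have min: "0 \<le> t\<^sup>2 * (cmod g)\<^sup>2 * (hnorm x)\<^sup>2 + 2 * t * (cmod g)\<^sup>2" for t :: real
    proof -
      let ?c = "of_real t * cnj g"
      have "J z \<le> J (z + hscale ?c x)" using Jz m_le order_trans by blast
      moreover have "J (z + hscale ?c x) = J z + (hnorm (hscale ?c x))\<^sup>2 + 2 * Re (?c * g)"
      proof -
        have "Re (cinner (hscale ?c x) z) = Re (cinner z (hscale ?c x))"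
          by (metis cinner_commute cnj.sel(1))
        then have "(hnorm (z + hscale ?c x))\<^sup>2
            = (hnorm z)\<^sup>2 + (hnorm (hscale ?c x))\<^sup>2 + 2 * Re (?c * cinner z x)"
          unfolding hnorm_sq cinner_add_left cinner_add_right by (simp add: cinner_hscale_right)
        then show ?thesis unfolding J_def g_def
          by (simp add: add sc algebra_simps)
      qed
      moreover have "?c * g = of_real (t * (cmod g)\<^sup>2)"
        by (simp add: complex_norm_square[symmetric] mult.commute[of "cnj g"] mult.assoc del: of_real_power)
      moreover have "(hnorm (hscale ?c x))\<^sup>2 = t\<^sup>2 * (cmod g)\<^sup>2 * (hnorm x)\<^sup>2"
        by (simp add: hnorm_hscale norm_mult power_mult_distrib)
      ultimately show ?thesis by simp
    qed
    have "g = 0"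
    proof (rule ccontr)
      assume "g \<noteq> 0"
      define h where "h = (hnorm x)\<^sup>2"
      have h: "h \<ge> 0" by (simp add: h_def)
      \<comment> \<open>Negative, with \<open>t * h > - 1\<close>, so that the linear term outweighs
        the quadratic one.\<close>
      define t where "t = - 1 / (1 + h)"
      have "0 \<le> (cmod g)\<^sup>2 * (t * (t * h + 2))"
        using min[of t] by (simp add: h_def algebra_simps power2_eq_square)
      moreover have "(cmod g)\<^sup>2 > 0" using \<open>g \<noteq> 0\<close> by simp
      ultimately have "0 \<le> t * (t * h + 2)" by (simp add: zero_le_mult_iff)
      moreover have "t < 0" "t * h + 2 > 0" using h by (simp_all add: t_def field_simps)
      ultimately show False by (simp add: zero_le_mult_iff)
    qed
    then show ?thesis by (simp add: g_def)
  qed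
  have "hnorm z \<le> \<bar>K\<bar>"
  proof (cases "hnorm z = 0")
    case False
    then have p: "hnorm z > 0" using hnorm_nonneg[of z] by linarith
    have "(hnorm z)\<^sup>2 \<le> K * hnorm z"
      using bd[of z] eq[of z] by (simp add: cinner_same norm_power)
    then have "hnorm z \<le> K" using p by (simp add: power2_eq_square)
    then show ?thesis by simp
  qed simp
  with eq show ?thesis using that by blast
qed

text \<open>The form is conjugate-linear in its first argument, so Riesz is applied to its conjugate
  for each fixed \<open>y\<close>. The resulting vector depends linearly on \<open>y\<close> because
  inner products separate vectors.\<close>

lemma form_representation:
  fixes q :: "'a::chilbert \<Rightarrow> 'a \<Rightarrow> complex"
  assumes addl: "\<And>x y z. q (x + y) z = q x z + q y z"
    and addr: "\<And>x y z. q z (x + y) = q z x + q z y"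
    and scl: "\<And>c x y. q (hscale c x) y = cnj c * q x y"
    and scr: "\<And>c x y. q x (hscale c y) = c * q x y"
    and bd: "\<And>x y. cmod (q x y) \<le> K * hnorm x * hnorm y" and K: "K \<ge> 0"
  obtains T where "bounded_op T" "\<And>x y. q x y = cinner x (T y)" "\<And>x. hnorm (T x) \<le> K * hnorm x"
proof -
  have "\<exists>z. (\<forall>x. cnj (q x y) = cinner z x) \<and> hnorm z \<le> K * hnorm y" for y
  proof -
    have "cmod (cnj (q x y)) \<le> (K * hnorm y) * hnorm x" for x
      using bd[of x y] by (simp add: algebra_simps)
    then obtain z where "\<And>x. cnj (q x y) = cinner z x" "hnorm z \<le> \<bar>K * hnorm y\<bar>"
      by (rule Riesz_representation[of "\<lambda>x. cnj (q x y)" "K * hnorm y", rotated 2])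
        (simp_all add: addl scl)
    then show ?thesis using K by (auto simp: abs_mult)
  qed
  then obtain T where T: "\<And>x y. cnj (q x y) = cinner (T y) x" and Tb: "\<And>y. hnorm (T y) \<le> K * hnorm y"
    by metis
  have q: "q x y = cinner x (T y)" for x y
    by (metis T cinner_commute complex_cnj_cnj)
  have "bounded_op T" unfolding bounded_op_def
  proof (intro conjI allI)
    show "T (x + y) = T x + T y" for x y
      by (rule cinner_ext_right) (simp add: cinner_simps q[symmetric] addr)
    show "T (hscale c x) = hscale c (T x)" for c x
      by (rule cinner_ext_right) (simp add: cinner_simps q[symmetric] scr)
    show "\<exists>K. \<forall>x. hnorm (T x) \<le> K * hnorm x" using Tb by blast
  qed
  with q Tb show ?thesis using that by blast
qed

section \<open>Bounded operators and the adjoint\<close>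

lemma bounded_op_add: "bounded_op T \<Longrightarrow> T (x + y) = T x + T y"
  by (simp add: bounded_op_def)

lemma bounded_op_hscale: "bounded_op T \<Longrightarrow> T (hscale c x) = hscale c (T x)"
  by (simp add: bounded_op_def)

lemma bounded_op_zero: "bounded_op T \<Longrightarrow> T 0 = 0"
  using bounded_op_hscale[of T 0 0] by simp

lemma bounded_op_minus: "bounded_op T \<Longrightarrow> T (- x) = - T x"
  using bounded_op_hscale[of T "-1" x] by (simp add: hscale_minus_one)

lemma bounded_op_diff: "bounded_op T \<Longrightarrow> T (x - y) = T x - T y"
  using bounded_op_add[of T x "-y"] by (simp add: bounded_op_minus)

lemma bounded_op_bound:
  assumes "bounded_op T" obtains K where "K > 0" "\<And>x. hnorm (T x) \<le> K * hnorm x"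
proof -
  obtain K where K: "\<And>x. hnorm (T x) \<le> K * hnorm x" using assms by (auto simp: bounded_op_def)
  have "hnorm (T x) \<le> (\<bar>K\<bar> + 1) * hnorm x" for x
  proof -
    have "K * hnorm x \<le> (\<bar>K\<bar> + 1) * hnorm x" by (rule mult_right_mono) auto
    then show ?thesis using K[of x] by linarith
  qed
  then show ?thesis using that[of "\<bar>K\<bar> + 1"] by auto
qed

text \<open>\<open>adj\<close> is defined by choice, so it has the adjoint property only once some
  adjoint is known to exist; representing the form \<open>cinner (T x) y\<close> supplies
  one.\<close>

lemma cinner_adj:
  assumes "bounded_op T" shows "cinner (T x) y = cinner x (adj T y)"
proof -
  obtain K where K: "K > 0" "\<And>x. hnorm (T x) \<le> K * hnorm x" using bounded_op_bound[OF assms] by blast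
  have "cmod (cinner (T x) y) \<le> K * hnorm x * hnorm y" for x y
    using Cauchy_Schwarz[of "T x" y] K(2)[of x] by (meson hnorm_nonneg mult_right_mono order_trans)
  then obtain S where "\<And>x y. cinner (T x) y = cinner x (S y)"
    by (rule form_representation[of "\<lambda>x y. cinner (T x) y" K, rotated 4])
      (use K(1) in \<open>simp_all add: bounded_op_add[OF assms] bounded_op_hscale[OF assms] cinner_simps\<close>)
  then have "\<exists>S. \<forall>x y. cinner (T x) y = cinner x (S y)" by blast
  from someI_ex[OF this] show ?thesis unfolding adj_def by blast
qed

lemma cinner_adj_left:
  assumes "bounded_op T" shows "cinner (adj T x) y = cinner x (T y)"
  by (metis assms cinner_adj cinner_commute)

lemma adj_unique:
  assumes "bounded_op T" "\<And>x y. cinner (T x) y = cinner x (S y)" shows "adj T = S"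
proof
  fix y show "adj T y = S y"
    by (rule cinner_ext_right) (simp add: assms(2) flip: cinner_adj[OF assms(1)])
qed

section \<open>Direct sums of Hilbert spaces\<close>

instantiation prod :: (chilbert, chilbert) chilbert
begin

definition hscale_prod :: "complex \<Rightarrow> 'a \<times> 'b \<Rightarrow> 'a \<times> 'b" where
  "hscale_prod c p = (hscale c (fst p), hscale c (snd p))"

definition cinner_prod :: "'a \<times> 'b \<Rightarrow> 'a \<times> 'b \<Rightarrow> complex" where
  "cinner_prod p q = cinner (fst p) (fst q) + cinner (snd p) (snd q)"

instance
proof
  fix x y z :: "'a \<times> 'b" and a b c :: complex
  show "hscale c (x + y) = hscale c x + hscale c y"
    "hscale (a + b) x = hscale a x + hscale b x"
    "hscale a (hscale b x) = hscale (a * b) x" "hscale 1 x = x"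
    by (simp_all add: hscale_prod_def prod_eq_iff hscale_add_right hscale_add_left hscale_hscale hscale_one)
  show "cinner (x + y) z = cinner x z + cinner y z"
    "cinner (hscale c x) y = cnj c * cinner x y"
    by (simp_all add: cinner_prod_def hscale_prod_def cinner_simps distrib_left)
  show "cinner y x = cnj (cinner x y)"
    by (simp add: cinner_prod_def cinner_commute[symmetric])
  show "0 \<le> Re (cinner x x)"
    by (simp add: cinner_prod_def cinner_pos)
  have "cinner x x = of_real ((hnorm (fst x))\<^sup>2 + (hnorm (snd x))\<^sup>2)"
    by (simp add: cinner_prod_def cinner_same)
  then have "cinner x x = 0 \<longleftrightarrow> (hnorm (fst x))\<^sup>2 + (hnorm (snd x))\<^sup>2 = 0"
    by (simp only: of_real_eq_0_iff)
  then show "cinner x x = 0 \<longleftrightarrow> x = 0"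
    by (simp add: sum_power2_eq_zero_iff prod_eq_iff)
next
  fix X :: "nat \<Rightarrow> 'a \<times> 'b"
  have sq: "sqrt (Re (cinner p p)) = sqrt ((hnorm (fst p))\<^sup>2 + (hnorm (snd p))\<^sup>2)" for p :: "'a \<times> 'b"
    by (simp add: cinner_prod_def hnorm_sq)
  assume *: "\<forall>e>0. \<exists>N::nat. \<forall>m\<ge>N. \<forall>n\<ge>N. sqrt (Re (cinner (X m - X n) (X m - X n))) < e"
  have "\<exists>N. \<forall>m\<ge>N. \<forall>n\<ge>N. hnorm (fst (X m) - fst (X n)) < e" if "e > 0" for e
    using *[rule_format, OF that] unfolding sq
    by (metis (no_types, lifting) fst_diff le_less_trans real_sqrt_sum_squares_ge1)
  then obtain a where a: "(\<lambda>n. hnorm (fst (X n) - a)) \<longlonglongrightarrow> 0"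
    using hilbert_Cauchy_convergent[of "\<lambda>n. fst (X n)"] by blast
  have "\<exists>N. \<forall>m\<ge>N. \<forall>n\<ge>N. hnorm (snd (X m) - snd (X n)) < e" if "e > 0" for e
    using *[rule_format, OF that] unfolding sq
    by (metis (no_types, lifting) snd_diff le_less_trans real_sqrt_sum_squares_ge2)
  then obtain b where b: "(\<lambda>n. hnorm (snd (X n) - b)) \<longlonglongrightarrow> 0"
    using hilbert_Cauchy_convergent[of "\<lambda>n. snd (X n)"] by blast
  have "(\<lambda>n. sqrt ((hnorm (fst (X n) - a))\<^sup>2 + (hnorm (snd (X n) - b))\<^sup>2)) \<longlonglongrightarrow> sqrt (0\<^sup>2 + 0\<^sup>2)"
    by (intro tendsto_intros a b)
  then have "(\<lambda>n. sqrt (Re (cinner (X n - (a, b)) (X n - (a, b))))) \<longlonglongrightarrow> 0"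
    by (simp add: sq)
  moreover have "0 \<le> Re (cinner p p)" for p :: "'a \<times> 'b"
    by (simp add: cinner_prod_def cinner_pos)
  ultimately show "\<exists>l. \<forall>e>0. \<exists>N::nat. \<forall>n\<ge>N. sqrt (Re (cinner (X n - l) (X n - l))) < e"
    by (auto simp: LIMSEQ_iff intro!: exI[of _ "(a, b)"])
qed

end

lemma hscale_Pair [simp]: "hscale c (x, y) = (hscale c x, hscale c y)"
  by (simp add: hscale_prod_def)

lemma cinner_Pair [simp]: "cinner (x, y) (x', y') = cinner x x' + cinner y y'"
  by (simp add: cinner_prod_def)

lemma hnorm_Pair_sq: "(hnorm (x, y))\<^sup>2 = (hnorm x)\<^sup>2 + (hnorm y)\<^sup>2"
  by (simp add: hnorm_sq)

lemma hnorm_le_Pair: "hnorm x \<le> hnorm (x, y)" "hnorm y \<le> hnorm (x, y)"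
  by (rule power2_le_imp_le; simp add: hnorm_Pair_sq)+

lemma hnorm_Pair_le: "hnorm (x, y) \<le> hnorm x + hnorm y"
  by (rule power2_le_imp_le) (simp_all add: hnorm_Pair_sq power2_sum)

subsection \<open>Positive operators\<close>

lemma op_ext:
  assumes "\<And>x y. cinner x (S y) = cinner x (T y)" shows "S = (T :: 'a::chilbert \<Rightarrow> 'a)"
  using assms by (intro ext cinner_ext_right) auto

lemma op_diff_eq: "op_diff S T = op_add S (op_scale (- 1) (T :: 'a::chilbert \<Rightarrow> 'a))"
  by (simp add: op_diff_def op_add_def op_scale_def hscale_minus_one)

lemma op_neg_eq: "op_neg T = op_scale (- 1) (T :: 'a::chilbert \<Rightarrow> 'a)"
  by (simp add: op_neg_def op_scale_def hscale_minus_one)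

lemma bounded_op_id: "bounded_op id"
  by (auto simp: bounded_op_def intro!: exI[of _ 1])

lemma bounded_op_op_scale: "bounded_op T \<Longrightarrow> bounded_op (op_scale c T)"
proof -
  assume b: "bounded_op T"
  then obtain K where "\<And>x. hnorm (T x) \<le> K * hnorm x" by (auto simp: bounded_op_def)
  then have "hnorm (op_scale c T x) \<le> (cmod c * K) * hnorm x" for x
    by (simp add: op_scale_def hnorm_hscale mult.assoc mult_left_mono)
  then show ?thesis using b
    unfolding bounded_op_def by (auto simp: op_scale_def hscale_add_right hscale_hscale mult.commute[of c]
      simp del: mult.assoc intro!: exI[of _ "cmod c * K"])
qed

lemma bounded_op_op_add: "bounded_op S \<Longrightarrow> bounded_op T \<Longrightarrow> bounded_op (op_add S T)"
proof -
  assume b: "bounded_op S" "bounded_op T"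
  then obtain K K' where "\<And>x. hnorm (S x) \<le> K * hnorm x" "\<And>x. hnorm (T x) \<le> K' * hnorm x"
    by (auto simp: bounded_op_def)
  then have "hnorm (op_add S T x) \<le> (K + K') * hnorm x" for x
    using hnorm_triangle[of "S x" "T x"] by (fastforce simp: op_add_def distrib_right intro: order_trans add_mono)
  then show ?thesis using b
    by (auto simp: bounded_op_def op_add_def hscale_add_right)
qed

lemma bounded_op_op_diff: "bounded_op S \<Longrightarrow> bounded_op T \<Longrightarrow> bounded_op (op_diff S T)"
  by (simp add: op_diff_eq bounded_op_op_add bounded_op_op_scale)

definition positive_op :: "('a::chilbert \<Rightarrow> 'a) \<Rightarrow> bool" where
  "positive_op T \<longleftrightarrow> (\<forall>v. Im (cinner v (T v)) = 0 \<and> 0 \<le> Re (cinner v (T v)))"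

text \<open>Polarization over the complex scalars: the vector \<open>x + y\<close> settles the
  imaginary parts and \<open>x + hscale \<i> y\<close> the real parts.\<close>

lemma positive_op_hermitian:
  assumes b: "bounded_op T" and p: "positive_op T"
  shows "cinner (T x) y = cinner x (T y)"
proof -
  have im: "Im (cinner v (T v)) = 0" for v using p by (simp add: positive_op_def)
  have "Im (cinner x (T y) + cinner y (T x)) = 0"
    using im[of "x + y"] im[of x] im[of y] by (simp add: bounded_op_add[OF b] cinner_simps)
  moreover have "Re (cinner x (T y)) - Re (cinner y (T x)) = 0"
    using im[of "x + hscale \<i> y"] im[of x] im[of y]
    by (simp add: bounded_op_add[OF b] bounded_op_hscale[OF b] cinner_simps)
  ultimately have "cinner x (T y) = cnj (cinner y (T x))"
    by (simp add: complex_eq_iff)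
  then show ?thesis by (simp add: cinner_commute[symmetric])
qed

lemma positive_op_Cauchy_Schwarz:
  assumes b: "bounded_op T" and p: "positive_op T"
  shows "(cmod (cinner x (T y)))\<^sup>2 \<le> Re (cinner x (T x)) * Re (cinner y (T y))"
proof (rule positive_form_Cauchy_Schwarz[of "\<lambda>x y. cinner x (T y)"])
  show "cinner y (T x) = cnj (cinner x (T y))" for x y
    using positive_op_hermitian[OF b p, of y x] by (metis cinner_commute)
qed (use p in \<open>simp_all add: bounded_op_add[OF b] bounded_op_hscale[OF b] cinner_simps positive_op_def\<close>)

text \<open>Cauchy-Schwarz for the form of \<open>T\<close> at \<open>T v\<close> and
  \<open>v\<close> bounds the fourth power of \<open>hnorm (T v)\<close> by the product of the
  squares of \<open>hnorm (T v)\<close> and \<open>hnorm v\<close>. The norm bound in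
  \<open>X_set\<close> can thus be expressed through the order alone.\<close>

lemma positive_le_id_contraction:
  assumes b: "bounded_op T" and p: "positive_op T" and q: "positive_op (op_diff id T)"
  shows "hnorm (T v) \<le> hnorm v"
proof -
  have le: "Re (cinner w (T w)) \<le> (hnorm w)\<^sup>2" for w
    using q[unfolded positive_op_def, rule_format, of w] by (simp add: op_diff_def cinner_simps hnorm_sq)
  have "((hnorm (T v))\<^sup>2)\<^sup>2 \<le> Re (cinner (T v) (T (T v))) * Re (cinner v (T v))"
    using positive_op_Cauchy_Schwarz[OF b p, of "T v" v] by (simp add: cinner_same norm_power)
  also have "\<dots> \<le> (hnorm (T v))\<^sup>2 * (hnorm v)\<^sup>2"
    using p by (intro mult_mono le) (auto simp: positive_op_def)
  finally have "(hnorm (T v))\<^sup>2 * (hnorm (T v))\<^sup>2 \<le> (hnorm (T v))\<^sup>2 * (hnorm v)\<^sup>2"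
    by (simp add: power2_eq_square)
  then have "(hnorm (T v))\<^sup>2 \<le> (hnorm v)\<^sup>2"
    by (cases "T v = 0") (simp, simp only: mult_le_cancel_left_pos zero_less_power2 hnorm_eq_0 simp_thms)
  then show ?thesis by (rule power2_le_imp_le) simp
qed

lemma contraction_positive_id_diff:
  assumes im: "\<And>v. Im (cinner v (T v)) = 0" and c: "\<And>v. hnorm (T v) \<le> hnorm v"
  shows "positive_op (op_diff id T)"
  unfolding positive_op_def
proof (intro allI conjI)
  fix v
  show "Im (cinner v (op_diff id T v)) = 0" by (simp add: op_diff_def cinner_simps im)
  have "Re (cinner v (T v)) \<le> hnorm v * hnorm (T v)"
    using Cauchy_Schwarz[of v "T v"] complex_Re_le_cmod order_trans by blast
  also have "\<dots> \<le> (hnorm v)\<^sup>2" using c[of v] by (simp add: power2_eq_square mult_left_mono)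
  finally show "0 \<le> Re (cinner v (op_diff id T v))" by (simp add: op_diff_def cinner_simps hnorm_sq)
qed

text \<open>The difference is positive with vanishing quadratic form, so Cauchy-Schwarz annihilates
  all its matrix coefficients.\<close>

lemma positive_op_antisym:
  assumes b: "bounded_op S" "bounded_op T"
    and p: "positive_op (op_diff S T)" and q: "positive_op (op_diff T S)"
  shows "S = T"
proof (rule op_ext)
  fix x y
  let ?D = "op_diff S T"
  have "Re (cinner x (?D x)) = 0" for x
    using p[unfolded positive_op_def, rule_format, of x] q[unfolded positive_op_def, rule_format, of x]
    by (simp add: op_diff_def cinner_simps)
  then have "(cmod (cinner x (?D y)))\<^sup>2 \<le> 0"
    using positive_op_Cauchy_Schwarz[OF bounded_op_op_diff[OF b] p, of x y] by simp
  then show "cinner x (S y) = cinner x (T y)" by (simp add: op_diff_def cinner_simps)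
qed

text \<open>If \<open>m\<close>, the infimum of the numerical range, were negative, \<open>T - m\<close> would be a positive operator
  that is not bounded below.\<close>

lemma positive_op_of_resolvents:
  fixes T :: "'a::chilbert \<Rightarrow> 'a"
  assumes b: "bounded_op T" and herm: "\<And>x y. cinner (T x) y = cinner x (T y)"
    and res: "\<And>t::real. t > 0 \<Longrightarrow> \<exists>K. \<forall>v. hnorm v \<le> K * hnorm (T v + hscale (of_real t) v)"
  shows "positive_op T"
proof (rule ccontr)
  assume "\<not> positive_op T"
  have im: "Im (cinner v (T v)) = 0" for v
  proof -
    have "cinner v (T v) = cnj (cinner v (T v))" by (metis herm cinner_commute)
    then have "Im (cinner v (T v)) = Im (cnj (cinner v (T v)))" by (rule arg_cong)
    then show ?thesis by simp
  qed
  define V where "V = {v::'a. hnorm v = 1}"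
  define r where "r v = Re (cinner v (T v))" for v
  have r_scale: "r (hscale (of_real s) v) = s\<^sup>2 * r v" for s v
    by (simp add: r_def bounded_op_hscale[OF b] cinner_simps power2_eq_square mult.assoc)
  have unit: "hscale (of_real (inverse (hnorm v))) v \<in> V" if "v \<noteq> 0" for v
    using that by (simp add: V_def hnorm_hscale norm_inverse)
  obtain v0 where v0: "r v0 < 0"
    using \<open>\<not> positive_op T\<close> im by (auto simp: positive_op_def r_def not_le)
  then have "v0 \<noteq> 0" by (auto simp: r_def)
  obtain K where K: "K > 0" "\<And>x. hnorm (T x) \<le> K * hnorm x" using bounded_op_bound[OF b] by blast
  have "- K \<le> r v" if "v \<in> V" for v
  proof -
    have "\<bar>r v\<bar> \<le> hnorm v * hnorm (T v)"
      unfolding r_def using Cauchy_Schwarz[of v "T v"] abs_Re_le_cmod order_trans by blast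
    then show ?thesis using K(2)[of v] that by (simp add: V_def)
  qed
  then have bdd: "bdd_below (r ` V)" by (rule bdd_belowI2)
  define m where "m = (INF v\<in>V. r v)"
  have m_le: "m \<le> r v" if "v \<in> V" for v unfolding m_def by (rule cINF_lower[OF bdd that])
  have "m < 0"
  proof -
    have "m \<le> (inverse (hnorm v0))\<^sup>2 * r v0"
      using m_le[OF unit[OF \<open>v0 \<noteq> 0\<close>]] by (simp only: r_scale)
    also have "\<dots> < 0" using v0 \<open>v0 \<noteq> 0\<close> by (simp add: mult_pos_neg)
    finally show ?thesis .
  qed
  \<comment> \<open>At \<open>t = - m > 0\<close> the hypothesis says that \<open>T - m\<close> is
    bounded below.\<close>
  then obtain L where L: "\<And>v. hnorm v \<le> L * hnorm (T v + hscale (of_real (- m)) v)"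
    using res[of "- m"] by auto
  define S where "S = op_add T (op_scale (of_real (- m)) id)"
  have S: "S v = T v + hscale (of_real (- m)) v" for v by (simp add: S_def op_add_def op_scale_def)
  have bS: "bounded_op S" unfolding S_def by (intro bounded_op_op_add bounded_op_op_scale b bounded_op_id)
  have rS: "Re (cinner v (S v)) = r v - m * (hnorm v)\<^sup>2" for v
    by (simp add: S cinner_simps r_def hnorm_sq)
  have pS: "positive_op S" unfolding positive_op_def
  proof (intro allI conjI)
    fix v
    show "Im (cinner v (S v)) = 0" by (simp add: S cinner_simps im)
    show "0 \<le> Re (cinner v (S v))"
    proof (cases "v = 0")
      case False
      then have n: "(hnorm v)\<^sup>2 > 0" by simp
      have "m \<le> (inverse (hnorm v))\<^sup>2 * r v" using m_le[OF unit[OF False]] by (simp only: r_scale)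
      then have "m * (hnorm v)\<^sup>2 \<le> r v" using n by (simp add: field_simps)
      then show ?thesis by (simp add: rS)
    qed simp
  qed
  obtain C where C: "C > 0" "\<And>x. hnorm (S x) \<le> C * hnorm x" using bounded_op_bound[OF bS] by blast
  \<comment> \<open>Cauchy-Schwarz for the form of \<open>S\<close> at \<open>S v\<close> and
    \<open>v\<close>; a lower bound on \<open>hnorm (S v)\<close> thereby becomes one on the
    numerical range of \<open>S\<close>.\<close>
  have est: "(hnorm (S v))\<^sup>2 \<le> C * Re (cinner v (S v))" for v
  proof (cases "hnorm (S v) = 0")
    case True
    then show ?thesis using pS C(1) by (simp add: positive_op_def)
  next
    case False
    have "((hnorm (S v))\<^sup>2)\<^sup>2 \<le> Re (cinner (S v) (S (S v))) * Re (cinner v (S v))"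
      using positive_op_Cauchy_Schwarz[OF bS pS, of "S v" v] by (simp add: cinner_same norm_power)
    also have "\<dots> \<le> (C * (hnorm (S v))\<^sup>2) * Re (cinner v (S v))"
    proof (rule mult_right_mono)
      have "Re (cinner (S v) (S (S v))) \<le> hnorm (S v) * hnorm (S (S v))"
        using Cauchy_Schwarz complex_Re_le_cmod order_trans by blast
      also have "\<dots> \<le> hnorm (S v) * (C * hnorm (S v))" by (intro mult_left_mono C) simp
      finally show "Re (cinner (S v) (S (S v))) \<le> C * (hnorm (S v))\<^sup>2"
        by (simp add: power2_eq_square algebra_simps)
    qed (use pS in \<open>simp add: positive_op_def\<close>)
    finally have "(hnorm (S v))\<^sup>2 * (hnorm (S v))\<^sup>2 \<le> (hnorm (S v))\<^sup>2 * (C * Re (cinner v (S v)))"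
      by (simp add: power2_eq_square algebra_simps)
    moreover have "(hnorm (S v))\<^sup>2 > 0" using False by simp
    ultimately show ?thesis by (simp only: mult_le_cancel_left_pos)
  qed
  \<comment> \<open>A uniform gap between the values of \<open>r\<close> on unit vectors and their
    infimum \<open>m\<close>. The sign of \<open>L\<close> is recorded with it because its proof
    uses a unit vector.\<close>
  have "m + inverse (L\<^sup>2 * C) \<le> r v \<and> L > 0" if "v \<in> V" for v
  proof -
    have n1: "hnorm v = 1" using that by (simp add: V_def)
    have one: "1 \<le> L * hnorm (S v)" using L[of v] by (simp add: S n1)
    have "L > 0"
    proof (rule ccontr)
      assume "\<not> L > 0"
      then have "L * hnorm (S v) \<le> 0" by (simp add: mult_nonpos_nonneg)
      with one show False by simp
    qed
    have "1 \<le> (L * hnorm (S v))\<^sup>2" using one by simp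
    also have "\<dots> \<le> L\<^sup>2 * (C * Re (cinner v (S v)))"
      unfolding power_mult_distrib by (intro mult_left_mono est) simp
    finally have "1 \<le> (L\<^sup>2 * C) * (r v - m)" by (simp add: rS n1 mult.assoc)
    moreover have "L\<^sup>2 * C > 0" using \<open>L > 0\<close> C(1) by simp
    ultimately have "inverse (L\<^sup>2 * C) \<le> r v - m"
      by (simp add: inverse_eq_divide pos_divide_le_eq mult.commute)
    then show ?thesis using \<open>L > 0\<close> by simp
  qed
  note ** = this
  have ne: "V \<noteq> {}" using unit[OF \<open>v0 \<noteq> 0\<close>] by blast
  then have "m + inverse (L\<^sup>2 * C) \<le> m" unfolding m_def[symmetric]
    using cINF_greatest[of V "m + inverse (L\<^sup>2 * C)" r] ** by (simp add: m_def[symmetric])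
  moreover have "inverse (L\<^sup>2 * C) > 0" using ne ** C(1) by (metis ex_in_conv inverse_positive_iff_positive mult_pos_pos zero_less_power)
  ultimately show False by linarith
qed

subsection \<open>Ultrafilters and weak limits\<close>

definition ultra :: "nat filter \<Rightarrow> bool" where
  "ultra U \<longleftrightarrow> U \<noteq> bot \<and> (\<forall>P. eventually P U \<or> eventually (\<lambda>n. \<not> P n) U)"

text \<open>Zorn's lemma for proper filters below \<open>sequentially\<close>, looking for a minimal
  one. Finitely many members of a chain have a least one, so finite meets, and hence the infimum of
  the chain, stay proper. Lying below \<open>sequentially\<close> is what makes the ultrafilter
  free.\<close>

lemma ultra_exists: obtains U where "ultra U" "U \<le> sequentially"
proof -
  define A where "A = {F::nat filter. F \<le> sequentially \<and> F \<noteq> bot}"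
  have "\<exists>m\<in>A. \<forall>a\<in>A. a \<le> m \<longrightarrow> a = m"
  proof (rule predicate_Zorn[where P = "\<lambda>F G. G \<le> F"])
    show "partial_order_on A (relation_of (\<lambda>F G. G \<le> F) A)"
      by (rule partial_order_on_relation_ofI) auto
    fix C assume "C \<in> Chains (relation_of (\<lambda>F G. G \<le> F) A)"
    then have CA: "C \<subseteq> A" and chain: "\<And>F G. F \<in> C \<Longrightarrow> G \<in> C \<Longrightarrow> F \<le> G \<or> G \<le> F"
      by (auto simp: Chains_def relation_of_def)
    \<comment> \<open>Inserting \<open>sequentially\<close> also provides a bound for the empty
      chain, whose infimum would be the top filter.\<close>
    define D where "D = insert sequentially C"
    have DA: "D \<subseteq> A" using CA by (auto simp: D_def A_def)
    have chainD: "F \<le> G \<or> G \<le> F" if "F \<in> D" "G \<in> D" for F G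
      using that chain CA by (auto simp: D_def A_def)
    have least: "\<exists>m\<in>X. \<forall>x\<in>X. m \<le> x" if "finite X" "X \<noteq> {}" "X \<subseteq> D" for X
      using that
    proof (induction X rule: finite_ne_induct)
      case (insert x F)
      then obtain m where "m \<in> F" "\<forall>y\<in>F. m \<le> y" by auto
      moreover have "x \<le> m \<or> m \<le> x" using chainD insert.prems \<open>m \<in> F\<close> by auto
      ultimately show ?case
      proof (elim disjE)
        assume "x \<le> m"
        then have "\<forall>y\<in>insert x F. x \<le> y" using \<open>\<forall>y\<in>F. m \<le> y\<close> by (blast intro: order_trans order_refl)
        then show ?thesis by blast
      qed blast
    qed auto
    have "Inf X \<noteq> bot" if X: "X \<subseteq> D" "finite X" for X
    proof (cases "X = {}")
      case False
      then obtain m where "m \<in> X" "\<forall>x\<in>X. m \<le> x"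
        using least[OF X(2) False X(1)] by blast
      then have "m \<le> Inf X" "m \<noteq> bot" using X DA by (auto simp: A_def intro: Inf_greatest)
      then show ?thesis by (metis bot_unique)
    qed (simp add: trivial_limit_def)
    then have "Inf D \<noteq> bot" by (rule Inf_filter_not_bot)
    moreover have "Inf D \<le> sequentially" by (rule Inf_lower) (simp add: D_def)
    moreover have "\<forall>F\<in>C. Inf D \<le> F" by (intro ballI Inf_lower) (simp add: D_def)
    ultimately show "\<exists>u\<in>A. \<forall>a\<in>C. u \<le> a" unfolding A_def by blast
  qed
  then obtain U where U: "U \<le> sequentially" "U \<noteq> bot"
    and min: "\<And>F. F \<le> U \<Longrightarrow> F \<noteq> bot \<Longrightarrow> F = U"
    unfolding A_def by (auto intro: order_trans)
  have "eventually P U \<or> eventually (\<lambda>n. \<not> P n) U" for P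
  proof (cases "eventually (\<lambda>n. \<not> P n) U")
    case False
    \<comment> \<open>If the negation of \<open>P\<close> is not eventual, restricting
      \<open>U\<close> to \<open>P\<close> is still proper, and minimality makes the restriction
      equal to \<open>U\<close>.\<close>
    then have "inf U (principal {n. P n}) \<noteq> bot"
      by (auto simp: trivial_limit_def eventually_inf_principal)
    then have "inf U (principal {n. P n}) = U" by (intro min) auto
    moreover have "eventually P (inf U (principal {n. P n}))"
      by (simp add: eventually_inf_principal)
    ultimately show ?thesis by simp
  qed simp
  with U show ?thesis using that by (auto simp: ultra_def)
qed

text \<open>Compactness of the disc gives a cluster point. Along an ultrafilter a neighbourhood that
  is not eventually hit is eventually missed, so the cluster point is a limit.\<close>

lemma ultra_bounded_convergent:
  fixes f :: "nat \<Rightarrow> complex"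
  assumes u: "ultra U" and bd: "\<And>n. cmod (f n) \<le> K"
  obtains l where "(f \<longlongrightarrow> l) U" "cmod l \<le> K"
proof -
  have "compact (cball 0 K :: complex set)" by simp
  moreover have "filtermap f U \<noteq> bot" using u by (simp add: ultra_def filtermap_bot_iff)
  moreover have "eventually (\<lambda>x. x \<in> cball 0 K) (filtermap f U)"
    by (simp add: eventually_filtermap bd)
  ultimately obtain l where l: "l \<in> cball 0 K" "inf (nhds l) (filtermap f U) \<noteq> bot"
    unfolding compact_filter by blast
  have "(f \<longlongrightarrow> l) U"
  proof (rule topological_tendstoI)
    fix S assume S: "open S" "l \<in> S"
    show "eventually (\<lambda>n. f n \<in> S) U"
    proof (rule ccontr)
      assume "\<not> ?thesis"
      then have "eventually (\<lambda>n. f n \<notin> S) U" using u by (auto simp: ultra_def)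
      then have "eventually (\<lambda>x. x \<notin> S) (filtermap f U)" by (simp add: eventually_filtermap)
      moreover have "eventually (\<lambda>x. x \<in> S) (nhds l)" using S by (rule eventually_nhds_in_open)
      ultimately have "eventually (\<lambda>x. False) (inf (nhds l) (filtermap f U))"
        unfolding eventually_inf by blast
      with l(2) show False by (simp add: trivial_limit_def)
    qed
  qed
  then show ?thesis using that l(1) by auto
qed

definition weak_limit :: "nat filter \<Rightarrow> (nat \<Rightarrow> 'a::chilbert \<Rightarrow> 'a) \<Rightarrow> ('a \<Rightarrow> 'a) \<Rightarrow> bool" where
  "weak_limit U T S \<longleftrightarrow> (\<forall>x y. ((\<lambda>n. cinner x (T n y)) \<longlongrightarrow> cinner x (S y)) U)"

text \<open>Weak operator compactness of balls: every coefficient has a limit along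
  \<open>U\<close>, the limits inherit sesquilinearity and the bound by uniqueness of limits, and
  the limiting form is represented by an operator.\<close>

lemma weak_limit_exists:
  fixes T :: "nat \<Rightarrow> 'a::chilbert \<Rightarrow> 'a"
  assumes u: "ultra U" and b: "\<And>n. bounded_op (T n)"
    and K: "\<And>n x. hnorm (T n x) \<le> K * hnorm x" "K \<ge> 0"
  obtains S where "bounded_op S" "\<And>x. hnorm (S x) \<le> K * hnorm x" "weak_limit U T S"
proof -
  have nb: "U \<noteq> bot" using u by (simp add: ultra_def)
  have bd: "cmod (cinner x (T n y)) \<le> K * hnorm x * hnorm y" for n x y
  proof -
    have "cmod (cinner x (T n y)) \<le> hnorm x * (K * hnorm y)"
      using Cauchy_Schwarz[of x "T n y"] mult_left_mono[OF K(1)[of n y] hnorm_nonneg[of x]] by linarith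
    then show ?thesis by (simp add: algebra_simps)
  qed
  have ex: "\<exists>l. ((\<lambda>n. cinner x (T n y)) \<longlongrightarrow> l) U \<and> cmod l \<le> K * hnorm x * hnorm y" for x y
    by (rule ultra_bounded_convergent[OF u, of "\<lambda>n. cinner x (T n y)", OF bd]) blast
  define q where "q x y = (SOME l. ((\<lambda>n. cinner x (T n y)) \<longlongrightarrow> l) U \<and> cmod l \<le> K * hnorm x * hnorm y)" for x y
  have q: "((\<lambda>n. cinner x (T n y)) \<longlongrightarrow> q x y) U" and qb: "cmod (q x y) \<le> K * hnorm x * hnorm y" for x y
    using someI_ex[OF ex] unfolding q_def by blast+
  have qI: "q x y = l" if "((\<lambda>n. cinner x (T n y)) \<longlongrightarrow> l) U" for x y l
    using tendsto_unique[OF nb q that] .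
  have add: "q (x + y) z = q x z + q y z" "q z (x + y) = q z x + q z y" for x y z
    by (rule qI, simp only: cinner_simps bounded_op_add[OF b], intro tendsto_add q)+
  have sc: "q (hscale c x) y = cnj c * q x y" "q x (hscale c y) = c * q x y" for c x y
    by (rule qI, simp only: cinner_simps bounded_op_hscale[OF b], intro tendsto_mult_left q)+
  obtain S where "bounded_op S" "\<And>x y. q x y = cinner x (S y)" "\<And>x. hnorm (S x) \<le> K * hnorm x"
    by (rule form_representation[OF add sc qb K(2)]) (rule that)
  then show ?thesis using that q by (simp add: weak_limit_def)
qed

section \<open>Closure properties of von Neumann algebras\<close>

lemma vna_bounded_op: "von_neumann_algebra M \<Longrightarrow> T \<in> M \<Longrightarrow> bounded_op T"
  and vna_id: "von_neumann_algebra M \<Longrightarrow> id \<in> M"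
  and vna_add: "von_neumann_algebra M \<Longrightarrow> S \<in> M \<Longrightarrow> T \<in> M \<Longrightarrow> op_add S T \<in> M"
  and vna_comp: "von_neumann_algebra M \<Longrightarrow> S \<in> M \<Longrightarrow> T \<in> M \<Longrightarrow> S \<circ> T \<in> M"
  and vna_scale: "von_neumann_algebra M \<Longrightarrow> T \<in> M \<Longrightarrow> op_scale c T \<in> M"
  and vna_adj: "von_neumann_algebra M \<Longrightarrow> T \<in> M \<Longrightarrow> adj T \<in> M"
  by (simp_all add: von_neumann_algebra_def)

lemma vna_diff: "von_neumann_algebra M \<Longrightarrow> S \<in> M \<Longrightarrow> T \<in> M \<Longrightarrow> op_diff S T \<in> M"
  by (simp add: op_diff_eq vna_add vna_scale)

lemma vna_neg: "von_neumann_algebra M \<Longrightarrow> T \<in> M \<Longrightarrow> op_neg T \<in> M"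
  by (simp add: op_neg_eq vna_scale)

lemma vna_zero: "von_neumann_algebra M \<Longrightarrow> op_zero \<in> M"
  using vna_scale[of M id 0] vna_id[of M] by (simp add: op_scale_def op_zero_def)

text \<open>The closure clause of \<open>von_neumann_algebra\<close> tests finitely many
  coefficients at a time, and along a filter finitely many eventual conditions hold
  together.\<close>

lemma vna_weak_limit:
  assumes v: "von_neumann_algebra M" and u: "ultra U" and T: "\<And>n. T n \<in> M"
    and S: "bounded_op S" "weak_limit U T S"
  shows "S \<in> M"
proof -
  have "\<exists>R\<in>M. \<forall>k<n. cmod (cinner (\<xi> k) (op_diff R S (\<eta> k))) < e"
    if "e > 0" for n :: nat and \<xi> \<eta> :: "nat \<Rightarrow> 'a" and e
  proof -
    have "eventually (\<lambda>j. cmod (cinner (\<xi> k) (op_diff (T j) S (\<eta> k))) < e) U" for k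
    proof -
      have "((\<lambda>j. cinner (\<xi> k) (T j (\<eta> k))) \<longlongrightarrow> cinner (\<xi> k) (S (\<eta> k))) U"
        using S(2) by (simp add: weak_limit_def)
      from tendstoD[OF this that] show ?thesis
        by (simp add: dist_norm op_diff_def cinner_simps)
    qed
    then have "eventually (\<lambda>j. \<forall>k\<in>{..<n}. cmod (cinner (\<xi> k) (op_diff (T j) S (\<eta> k))) < e) U"
      by (intro eventually_ball_finite) auto
    then obtain j where "\<forall>k\<in>{..<n}. cmod (cinner (\<xi> k) (op_diff (T j) S (\<eta> k))) < e"
      using eventually_happens'[of U] u unfolding ultra_def by blast
    then show ?thesis using T by (auto intro!: bexI[of _ "T j"])
  qed
  then show ?thesis using v S(1) unfolding von_neumann_algebra_def by blast
qed

section \<open>Sigma-weak functionals\<close>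

lemma sw_functional_term_le:
  fixes T :: "'a::chilbert \<Rightarrow> 'a"
  assumes "\<And>x. hnorm (T x) \<le> K * hnorm x" "K \<ge> 0"
  shows "cmod (cinner x (T y)) \<le> K * ((hnorm x)\<^sup>2 + (hnorm y)\<^sup>2)"
proof -
  have "cmod (cinner x (T y)) \<le> hnorm x * (K * hnorm y)"
    using Cauchy_Schwarz[of x "T y"] mult_left_mono[OF assms(1)[of y] hnorm_nonneg[of x]] by linarith
  also have "\<dots> = K * (hnorm x * hnorm y)" by simp
  \<comment> \<open>The product is traded for a sum of squares, which is summable in the index for
    square-summable sequences of vectors.\<close>
  also have "hnorm x * hnorm y \<le> (hnorm x)\<^sup>2 + (hnorm y)\<^sup>2"
  proof -
    have "2 * (hnorm x * hnorm y) \<le> (hnorm x)\<^sup>2 + (hnorm y)\<^sup>2"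
      using sum_squares_bound[of "hnorm x" "hnorm y"] by simp
    moreover have "0 \<le> hnorm x * hnorm y" by simp
    ultimately show ?thesis by linarith
  qed
  finally show ?thesis using assms(2) by (simp add: mult_left_mono)
qed

lemma sw_functional_le:
  assumes "sq_summable \<xi>" "sq_summable \<eta>" "\<And>x. hnorm (T x) \<le> K * hnorm x" "K \<ge> 0"
  shows "cmod (sw_functional \<xi> \<eta> T) \<le> K * (\<Sum>n. (hnorm (\<xi> n))\<^sup>2 + (hnorm (\<eta> n))\<^sup>2)"
proof -
  have s: "summable (\<lambda>n. (hnorm (\<xi> n))\<^sup>2 + (hnorm (\<eta> n))\<^sup>2)"
    using assms(1,2) by (auto simp: sq_summable_def intro: summable_add)
  have le: "cmod (cinner (\<xi> n) (T (\<eta> n))) \<le> K * ((hnorm (\<xi> n))\<^sup>2 + (hnorm (\<eta> n))\<^sup>2)" for n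
    by (rule sw_functional_term_le[OF assms(3,4)])
  have "cmod (sw_functional \<xi> \<eta> T) \<le> (\<Sum>n. K * ((hnorm (\<xi> n))\<^sup>2 + (hnorm (\<eta> n))\<^sup>2))"
    unfolding sw_functional_def by (intro norm_suminf_le le summable_mult s)
  also have "\<dots> = K * (\<Sum>n. (hnorm (\<xi> n))\<^sup>2 + (hnorm (\<eta> n))\<^sup>2)"
    by (rule suminf_mult[OF s])
  finally show ?thesis .
qed

text \<open>Dominated convergence for series: each term tends to zero, and the common bound
  \<open>K\<close> yields a summable majorant. Weak operator limits of bounded sequences are
  therefore sigma-weak limits.\<close>

lemma sw_functional_weak_limit:
  assumes u: "ultra U" and T: "\<And>n x. hnorm (T n x) \<le> K * hnorm x"
    and S: "\<And>x. hnorm (S x) \<le> K * hnorm x" and K: "K \<ge> 0" and l: "weak_limit U T S"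
    and sq: "sq_summable \<xi>" "sq_summable \<eta>"
  shows "((\<lambda>n. sw_functional \<xi> \<eta> (op_diff (T n) S)) \<longlongrightarrow> 0) U"
proof -
  have bd: "hnorm (op_diff (T n) S x) \<le> (2 * K) * hnorm x" for n x
    using hnorm_triangle[of "T n x" "- S x"] T[of n x] S[of x] by (simp add: op_diff_def)
  have lim: "((\<lambda>n. cinner (\<xi> k) (op_diff (T n) S (\<eta> k))) \<longlongrightarrow> 0) U" for k
  proof -
    have "((\<lambda>n. cinner (\<xi> k) (T n (\<eta> k)) - cinner (\<xi> k) (S (\<eta> k)))
        \<longlongrightarrow> cinner (\<xi> k) (S (\<eta> k)) - cinner (\<xi> k) (S (\<eta> k))) U"
      by (intro tendsto_intros) (use l in \<open>simp add: weak_limit_def\<close>)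
    then show ?thesis by (simp add: op_diff_def cinner_simps)
  qed
  have le: "cmod (cinner (\<xi> k) (op_diff (T n) S (\<eta> k)))
      \<le> 2 * K * ((hnorm (\<xi> k))\<^sup>2 + (hnorm (\<eta> k))\<^sup>2)" for k n
    using sw_functional_term_le[OF bd] K by simp
  have sm: "summable (\<lambda>k. 2 * K * ((hnorm (\<xi> k))\<^sup>2 + (hnorm (\<eta> k))\<^sup>2))"
    using sq by (intro summable_mult summable_add) (auto simp: sq_summable_def)
  have "eventually (\<lambda>(k, n). cmod (cinner (\<xi> k) (op_diff (T n) S (\<eta> k)))
      \<le> 2 * K * ((hnorm (\<xi> k))\<^sup>2 + (hnorm (\<eta> k))\<^sup>2)) (at_top \<times>\<^sub>F U)"
    by (rule always_eventually) (use le in auto)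
  from tannerys_theorem[OF lim this sm]
  have "((\<lambda>n. \<Sum>k. cinner (\<xi> k) (op_diff (T n) S (\<eta> k))) \<longlongrightarrow> (\<Sum>k. 0)) U"
    using u by (simp add: ultra_def)
  then show ?thesis by (simp add: sw_functional_def)
qed

section \<open>The norm of a Lip-von Neumann algebra on bounded sets\<close>

lemma LvNA_vna: "LvNA M L \<Longrightarrow> von_neumann_algebra M"
  and LvNA_nonneg: "LvNA M L \<Longrightarrow> x \<in> M \<Longrightarrow> 0 \<le> L x"
  and LvNA_eq_0: "LvNA M L \<Longrightarrow> x \<in> M \<Longrightarrow> L x = 0 \<longleftrightarrow> x = op_zero"
  and LvNA_scale: "LvNA M L \<Longrightarrow> x \<in> M \<Longrightarrow> L (op_scale c x) = cmod c * L x"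
  and LvNA_add: "LvNA M L \<Longrightarrow> x \<in> M \<Longrightarrow> y \<in> M \<Longrightarrow> L (op_add x y) \<le> L x + L y"
  by (simp_all add: LvNA_def)

lemma LvNA_nbhd:
  fixes M :: "('a::chilbert \<Rightarrow> 'a) set"
  assumes "LvNA M L" "B \<subseteq> M" "op_bounded_set B" "x \<in> B" "e > 0"
  shows "\<exists>(m::nat) (\<xi>::nat \<Rightarrow> nat \<Rightarrow> 'a) \<eta> d. d > 0 \<and>
    (\<forall>k<m. sq_summable (\<xi> k) \<and> sq_summable (\<eta> k)) \<and>
    (\<forall>y\<in>B. (\<forall>k<m. cmod (sw_functional (\<xi> k) (\<eta> k) (op_diff y x)) < d) \<longrightarrow> L (op_diff y x) < e)"
proof -
  note top = assms(1)[unfolded LvNA_def, THEN conjunct2, THEN conjunct2, THEN conjunct2,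
      THEN conjunct2, THEN conjunct2, rule_format, OF assms(2-4), of "{y. L (op_diff y x) < e}"]
  have "\<exists>e'>0. \<forall>y\<in>B. L (op_diff y x) < e' \<longrightarrow> y \<in> {y. L (op_diff y x) < e}"
    using assms(5) by blast
  from iffD1[OF top this] show ?thesis by (simp only: mem_Collect_eq)
qed

text \<open>Compatibility of \<open>L\<close> with the w*-topology enters here: the sequence
  together with its limit is a bounded set, on which every \<open>L\<close>-ball around
  \<open>S\<close> contains a sigma-weak neighbourhood of \<open>S\<close>.\<close>

lemma LvNA_weak_limit:
  assumes L: "LvNA M L" and u: "ultra U" and TM: "\<And>n. T n \<in> M"
    and T: "\<And>n x. hnorm (T n x) \<le> K * hnorm x"
    and S: "S \<in> M" "\<And>x. hnorm (S x) \<le> K * hnorm x" and K: "K \<ge> 0" and l: "weak_limit U T S"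
  shows "((\<lambda>n. L (op_diff (T n) S)) \<longlongrightarrow> 0) U"
proof (rule tendstoI)
  fix e :: real assume e: "e > 0"
  let ?B = "insert S (range T)"
  have B: "?B \<subseteq> M" "op_bounded_set ?B" using TM S T by (auto simp: op_bounded_set_def)
  obtain d and m :: nat and \<xi> \<eta> where d: "d > 0"
    and sq: "\<forall>k<m. sq_summable (\<xi> k) \<and> sq_summable (\<eta> k)"
    and L_less: "\<forall>y\<in>?B. (\<forall>k<m. cmod (sw_functional (\<xi> k) (\<eta> k) (op_diff y S)) < d)
      \<longrightarrow> L (op_diff y S) < e"
    using LvNA_nbhd[OF L B insertI1 e] by (elim exE conjE)
  have "eventually (\<lambda>n. cmod (sw_functional (\<xi> k) (\<eta> k) (op_diff (T n) S)) < d) U" if "k < m" for k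
    using tendstoD[OF sw_functional_weak_limit[OF u T S(2) K l] d] sq[rule_format, OF that] by simp
  then have "eventually (\<lambda>n. \<forall>k\<in>{..<m}. cmod (sw_functional (\<xi> k) (\<eta> k) (op_diff (T n) S)) < d) U"
    by (intro eventually_ball_finite) auto
  then show "eventually (\<lambda>n. dist (L (op_diff (T n) S)) 0 < e) U"
  proof eventually_elim
    case (elim n)
    then have "L (op_diff (T n) S) < e" by (intro L_less[rule_format]) auto
    moreover have "0 \<le> L (op_diff (T n) S)"
      by (intro LvNA_nonneg[OF L] vna_diff[OF LvNA_vna[OF L]] TM S)
    ultimately show ?case by simp
  qed
qed

text \<open>Finitely many sigma-weak functionals are bounded on the unit ball, so a multiple of any
  neighbourhood of zero that they define contains the ball. Homogeneity of \<open>L\<close> turns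
  the factor into a bound.\<close>

lemma LvNA_bounded_on_ball:
  assumes L: "LvNA M L"
  obtains C where "C \<ge> 0" "\<And>x. x \<in> M \<Longrightarrow> (\<And>v. hnorm (x v) \<le> hnorm v) \<Longrightarrow> L x \<le> C"
proof -
  note v = LvNA_vna[OF L]
  let ?B = "{x \<in> M. \<forall>v. hnorm (x v) \<le> hnorm v}"
  have B: "?B \<subseteq> M" "op_bounded_set ?B" by (auto simp: op_bounded_set_def intro!: exI[of _ 1])
  have z: "op_zero \<in> ?B" using vna_zero[OF v] by (simp add: op_zero_def)
  have diff0: "op_diff y op_zero = y" for y :: "'a \<Rightarrow> 'a" by (simp add: op_diff_def op_zero_def)
  obtain d and m :: nat and \<xi> \<eta> where d: "d > 0"
    and sq: "\<forall>k<m. sq_summable (\<xi> k) \<and> sq_summable (\<eta> k)"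
    and L_less: "\<forall>y\<in>?B. (\<forall>k<m. cmod (sw_functional (\<xi> k) (\<eta> k) (op_diff y op_zero)) < d)
      \<longrightarrow> L (op_diff y op_zero) < 1"
    using LvNA_nbhd[OF L B z zero_less_one] by (elim exE conjE)
  define c where "c k = (\<Sum>n. (hnorm (\<xi> k n))\<^sup>2 + (hnorm (\<eta> k n))\<^sup>2)" for k
  have c: "c k \<ge> 0" if "k < m" for k
    unfolding c_def using sq[rule_format, OF that] by (intro suminf_nonneg summable_add) (auto simp: sq_summable_def)
  \<comment> \<open>\<open>c k\<close> bounds the \<open>k\<close>-th functional on the unit ball;
    division by \<open>s\<close> brings it below \<open>d\<close>, and \<open>s \<ge> 1\<close>
    keeps the scaled operator in the ball.\<close>
  define s where "s = 1 + (\<Sum>k<m. c k) / d"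
  have "0 \<le> (\<Sum>k<m. c k) / d" using d c by (intro divide_nonneg_pos sum_nonneg) auto
  then have s1: "s \<ge> 1" by (simp add: s_def)
  have "L x \<le> s" if x: "x \<in> M" "\<And>v. hnorm (x v) \<le> hnorm v" for x
  proof -
    let ?y = "op_scale (of_real (inverse s)) x"
    have yn: "hnorm (?y v) \<le> inverse s * hnorm v" for v
      using s1 x(2) by (simp add: op_scale_def hnorm_hscale norm_inverse)
    have "inverse s * hnorm v \<le> 1 * hnorm v" for v :: 'a
      using s1 by (intro mult_right_mono) (auto simp: inverse_le_1_iff)
    then have yB: "?y \<in> ?B" using vna_scale[OF v x(1)] yn by (fastforce intro: order_trans)
    have "L ?y < 1"
    proof -
      have "cmod (sw_functional (\<xi> k) (\<eta> k) ?y) < d" if "k < m" for k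
      proof -
        have "c k \<le> (\<Sum>k<m. c k)" using that c by (intro member_le_sum) auto
        also have "\<dots> < d * s" using d by (simp add: s_def distrib_left)
        finally have "inverse s * c k < d" using s1 by (simp add: field_simps)
        moreover have "cmod (sw_functional (\<xi> k) (\<eta> k) ?y) \<le> inverse s * c k"
          unfolding c_def using sq[rule_format, OF that] s1 yn by (intro sw_functional_le) auto
        ultimately show ?thesis by linarith
      qed
      then show ?thesis using L_less[rule_format, OF yB] by (simp add: diff0)
    qed
    then have "inverse s * L x < 1" using LvNA_scale[OF L x(1)] s1 by (simp add: norm_inverse)
    then show ?thesis using s1 by (simp add: field_simps)
  qed
  then show ?thesis using that[of s] s1 by auto
qed

subsection \<open>Two-by-two operator matrices\<close>

text \<open>Matrices act on the Hilbert sum \<open>'a \<times> 'a\<close>, so everything about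
  positive operators on a \<open>chilbert\<close> type applies to them directly.\<close>

definition mat_op :: "'a::chilbert mat2 \<Rightarrow> 'a \<times> 'a \<Rightarrow> 'a \<times> 'a" where
  "mat_op A p = (A False False (fst p) + A False True (snd p), A True False (fst p) + A True True (snd p))"

definition mat22 :: "('a \<Rightarrow> 'a) \<Rightarrow> ('a \<Rightarrow> 'a) \<Rightarrow> ('a \<Rightarrow> 'a) \<Rightarrow> ('a \<Rightarrow> 'a) \<Rightarrow> 'a::chilbert mat2" where
  "mat22 a b c d = (\<lambda>i j. if i then (if j then d else c) else (if j then b else a))"

definition mat_id :: "'a::chilbert mat2" where
  "mat_id = (\<lambda>i j. if i = j then id else op_zero)"

definition mat_mult :: "'a::chilbert mat2 \<Rightarrow> 'a mat2 \<Rightarrow> 'a mat2" where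
  "mat_mult A B = (\<lambda>i j. op_add (A i False \<circ> B False j) (A i True \<circ> B True j))"

definition mat_scale :: "complex \<Rightarrow> 'a::chilbert mat2 \<Rightarrow> 'a mat2" where
  "mat_scale c A = (\<lambda>i j. op_scale c (A i j))"

definition mat_add :: "'a::chilbert mat2 \<Rightarrow> 'a mat2 \<Rightarrow> 'a mat2" where
  "mat_add A B = (\<lambda>i j. op_add (A i j) (B i j))"

lemma mat22_simps [simp]:
  "mat22 a b c d False False = a" "mat22 a b c d False True = b"
  "mat22 a b c d True False = c" "mat22 a b c d True True = d"
  by (simp_all add: mat22_def)

lemma mat_op_mat22: "mat_op (mat22 a b c d) (u, v) = (a u + b v, c u + d v)"
  by (simp add: mat_op_def)

lemma mat_op_mat_id: "mat_op mat_id = id"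
  by (auto simp: fun_eq_iff mat_op_def mat_id_def op_zero_def)

lemma mat_op_mat_scale: "mat_op (mat_scale c A) = op_scale c (mat_op A)"
  by (auto simp: fun_eq_iff mat_op_def mat_scale_def op_scale_def hscale_add_right)

lemma mat_op_mat_add: "mat_op (mat_add A B) = op_add (mat_op A) (mat_op B)"
  by (auto simp: fun_eq_iff mat_op_def mat_add_def op_add_def add_ac)

lemma mat_op_mat_mult:
  assumes "\<And>i j. bounded_op (A i j)"
  shows "mat_op (mat_mult A B) = mat_op A \<circ> mat_op B"
  by (auto simp: fun_eq_iff mat_op_def mat_mult_def op_add_def bounded_op_add[OF assms] add_ac)

lemma bounded_op_mat_op:
  assumes b: "\<And>i j. bounded_op (A i j)"
  shows "bounded_op (mat_op A)"
proof -
  have "\<exists>K>0. \<forall>x. hnorm (A i j x) \<le> K * hnorm x" for i j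
    using bounded_op_bound[OF b] by metis
  then obtain K where K: "\<And>i j. K i j > 0" "\<And>i j x. hnorm (A i j x) \<le> K i j * hnorm x" by metis
  let ?K = "K False False + K False True + K True False + K True True"
  have "hnorm (mat_op A p) \<le> ?K * hnorm p" for p
  proof -
    obtain u v where p: "p = (u, v)" by (cases p)
    have le: "hnorm (A i j w) \<le> K i j * hnorm p" if "hnorm w \<le> hnorm p" for i j w
      using K(2)[of i j w] mult_left_mono[OF that, of "K i j"] K(1)[of i j] by linarith
    have uv: "hnorm u \<le> hnorm p" "hnorm v \<le> hnorm p" unfolding p by (rule hnorm_le_Pair)+
    have "hnorm (mat_op A p) \<le> hnorm (A False False u + A False True v) + hnorm (A True False u + A True True v)"
      unfolding p mat_op_def fst_conv snd_conv by (rule hnorm_Pair_le)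
    also have "\<dots> \<le> (hnorm (A False False u) + hnorm (A False True v))
        + (hnorm (A True False u) + hnorm (A True True v))"
      by (intro add_mono hnorm_triangle)
    also have "\<dots> \<le> (K False False * hnorm p + K False True * hnorm p)
        + (K True False * hnorm p + K True True * hnorm p)"
      by (intro add_mono le uv)
    finally show ?thesis by (simp add: algebra_simps)
  qed
  then show ?thesis
    unfolding bounded_op_def mat_op_def
    by (auto simp: bounded_op_add[OF b] bounded_op_hscale[OF b] hscale_add_right hscale_prod_def add_ac
        intro!: exI[of _ ?K])
qed

lemma mat_entry_le:
  assumes b: "\<And>i j. bounded_op (A i j)" and le: "\<And>p. hnorm (mat_op A p) \<le> K * hnorm p"
  shows "hnorm (A i j x) \<le> K * hnorm x"
proof -
  have n: "hnorm (x, 0::'a) = hnorm x" "hnorm (0::'a, x) = hnorm x" by (simp_all add: hnorm_def)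
  have "hnorm (A False False x) \<le> hnorm (mat_op A (x, 0))" "hnorm (A True False x) \<le> hnorm (mat_op A (x, 0))"
    by (simp_all add: mat_op_def bounded_op_zero[OF b] hnorm_le_Pair)
  moreover have "hnorm (A False True x) \<le> hnorm (mat_op A (0, x))" "hnorm (A True True x) \<le> hnorm (mat_op A (0, x))"
    by (simp_all add: mat_op_def bounded_op_zero[OF b] hnorm_le_Pair)
  ultimately show ?thesis using le[of "(x, 0)"] le[of "(0, x)"]
    by (cases i; cases j) (auto simp: n)
qed

lemma mat_op_inject:
  assumes "\<And>i j. bounded_op (A i j)" "\<And>i j. bounded_op (B i j)" "mat_op A = mat_op B"
  shows "A = B"
proof -
  have "A i j x = B i j x" for i j x
    using fun_cong[OF assms(3), of "(x, 0)"] fun_cong[OF assms(3), of "(0, x)"]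
    by (cases i; cases j) (simp_all add: mat_op_def bounded_op_zero[OF assms(1)] bounded_op_zero[OF assms(2)])
  then show ?thesis by (simp add: fun_eq_iff)
qed

lemma mat_op_hermitian_imp:
  assumes b: "\<And>i j. bounded_op (A i j)" and h: "\<And>p q. cinner (mat_op A p) q = cinner p (mat_op A q)"
  shows "adj (A i j) = A j i"
proof (rule adj_unique[OF b])
  fix x y
  show "cinner (A i j x) y = cinner x (A j i y)"
    using h[of "(x, 0)" "(y, 0)"] h[of "(x, 0)" "(0, y)"] h[of "(0, x)" "(y, 0)"] h[of "(0, x)" "(0, y)"]
    by (cases i; cases j) (simp_all add: mat_op_def bounded_op_zero[OF b])
qed

lemma mat_op_hermitianI:
  assumes b: "\<And>i j. bounded_op (A i j)" and h: "\<And>i j. adj (A i j) = A j i"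
  shows "cinner (mat_op A p) q = cinner p (mat_op A q)"
proof -
  have "cinner (A i j x) y = cinner x (A j i y)" for i j x y
    using cinner_adj[OF b, of i j x y] by (simp add: h)
  then show ?thesis by (cases p; cases q) (simp add: mat_op_def cinner_simps)
qed

lemma X_set_iff_contraction:
  "A \<in> X_set M \<longleftrightarrow> (\<forall>i j. A i j \<in> M) \<and> positive_op (mat_op A) \<and> (\<forall>p. hnorm (mat_op A p) \<le> hnorm p)"
proof -
  define f where "f p = (\<lambda>b. if b then snd p else fst p)" for p :: "'a \<times> 'a"
  have f: "f (v False, v True) = v" for v by (auto simp: f_def)
  have all: "(\<forall>v. P v) \<longleftrightarrow> (\<forall>p. P (f p))" for P by (metis f)
  have n: "hnorm (mat_op A p) \<le> hnorm p \<longleftrightarrow> (hnorm (mat_op A p))\<^sup>2 \<le> (hnorm p)\<^sup>2" for p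
    by (simp add: power2_le_iff_abs_le)
  have "(let z = cinner (f p False) (mat2_apply A (f p) False) + cinner (f p True) (mat2_apply A (f p) True)
          in Im z = 0 \<and> 0 \<le> Re z) \<longleftrightarrow> Im (cinner p (mat_op A p)) = 0 \<and> 0 \<le> Re (cinner p (mat_op A p))" for p
    by (cases p) (simp add: Let_def mat_op_def mat2_apply_def f_def)
  moreover have "(hnorm (mat2_apply A (f p) False))\<^sup>2 + (hnorm (mat2_apply A (f p) True))\<^sup>2
          \<le> (hnorm (f p False))\<^sup>2 + (hnorm (f p True))\<^sup>2 \<longleftrightarrow> hnorm (mat_op A p) \<le> hnorm p" for p
    unfolding n by (cases p) (simp add: mat_op_def mat2_apply_def f_def hnorm_Pair_sq)
  ultimately show ?thesis unfolding X_set_def positive_op_def by (simp add: all)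
qed

lemma X_set_mem: "A \<in> X_set M \<Longrightarrow> A i j \<in> M"
  by (simp add: X_set_def)

text \<open>Positivity of \<open>id - A\<close> replaces the norm bound. In this form membership
  passes to weak limits and to images under unital linear maps that preserve positivity of
  matrices.\<close>

lemma X_set_iff:
  assumes v: "von_neumann_algebra M"
  shows "A \<in> X_set M \<longleftrightarrow> (\<forall>i j. A i j \<in> M) \<and> positive_op (mat_op A) \<and> positive_op (op_diff id (mat_op A))"
proof (cases "\<forall>i j. A i j \<in> M")
  case True
  then have b: "bounded_op (mat_op A)" by (intro bounded_op_mat_op vna_bounded_op[OF v]) simp
  show ?thesis unfolding X_set_iff_contraction
    using contraction_positive_id_diff[of "mat_op A"] positive_le_id_contraction[OF b]
    by (auto simp: positive_op_def)
qed (auto simp: X_set_iff_contraction)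

lemma X_set_entry_le:
  assumes "von_neumann_algebra M" "A \<in> X_set M"
  shows "hnorm (A i j x) \<le> hnorm x"
proof -
  have "hnorm (mat_op A p) \<le> 1 * hnorm p" for p
    using assms(2) by (simp add: X_set_iff_contraction del: split_paired_All)
  from mat_entry_le[OF vna_bounded_op[OF assms(1) X_set_mem[OF assms(2)]] this]
  show ?thesis by simp
qed

lemma zero_in_X_set: "von_neumann_algebra M \<Longrightarrow> (\<lambda>i j. op_zero) \<in> X_set M"
proof -
  have "mat_op (\<lambda>i j. op_zero) = (\<lambda>p. 0 :: 'a \<times> 'a)"
    by (simp add: fun_eq_iff mat_op_def op_zero_def zero_prod_def)
  then show "von_neumann_algebra M \<Longrightarrow> (\<lambda>i j. op_zero) \<in> X_set M"
    by (simp add: X_set_iff_contraction vna_zero positive_op_def)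
qed

lemma positive_op_scale: "positive_op T \<Longrightarrow> 0 \<le> s \<Longrightarrow> positive_op (op_scale (of_real s) T)"
  by (simp add: positive_op_def op_scale_def cinner_simps)

lemma positive_mat_scaled_in_X_set:
  assumes v: "von_neumann_algebra M" and A: "\<And>i j. A i j \<in> M" and p: "positive_op (mat_op A)"
  obtains s :: real where "s > 0" "mat_scale (of_real s) A \<in> X_set M"
proof -
  have "bounded_op (mat_op A)" by (intro bounded_op_mat_op vna_bounded_op[OF v] A)
  then obtain K where K: "K > 0" "\<And>p. hnorm (mat_op A p) \<le> K * hnorm p" using bounded_op_bound by blast
  have "hnorm (op_scale (of_real (inverse K)) (mat_op A) p) \<le> hnorm p" for p
  proof -
    have "cmod (of_real (inverse K)) = inverse K" using K(1) by (simp add: norm_inverse)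
    then have "hnorm (op_scale (of_real (inverse K)) (mat_op A) p) = inverse K * hnorm (mat_op A p)"
      by (simp only: op_scale_def hnorm_hscale)
    also have "\<dots> \<le> inverse K * (K * hnorm p)" using K by (intro mult_left_mono) auto
    also have "\<dots> = hnorm p" using K(1) by simp
    finally show ?thesis .
  qed
  moreover have "positive_op (op_scale (of_real (inverse K)) (mat_op A))"
    using p K(1) by (intro positive_op_scale) auto
  ultimately have "mat_scale (of_real (inverse K)) A \<in> X_set M"
    by (simp add: X_set_iff_contraction mat_op_mat_scale del: of_real_inverse)
      (simp add: mat_scale_def vna_scale[OF v] A)
  then show ?thesis using that[of "inverse K"] K(1) by simp
qed

text \<open>The diagonal contributes \<open>K\<close> times the squared norm of
  \<open>(u, v)\<close>, which absorbs the cross term \<open>2 * Re (cinner u (x v))\<close>. An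
  arbitrary \<open>x\<close> thus becomes a corner of a positive matrix.\<close>

lemma positive_mat_dilation:
  assumes b: "bounded_op x" and K: "\<And>v. hnorm (x v) \<le> K * hnorm v" "K \<ge> 0"
  shows "positive_op (mat_op (mat22 (op_scale (of_real K) id) x (adj x) (op_scale (of_real K) id)))"
  unfolding positive_op_def
proof (rule allI)
  fix p :: "'a \<times> 'a"
  obtain u v where p: "p = (u, v)" by (cases p)
  let ?z = "cinner u (x v)"
  have "cinner v (adj x u) = cnj ?z"
    by (metis b cinner_adj cinner_commute)
  then have z: "cinner p (mat_op (mat22 (op_scale (of_real K) id) x (adj x) (op_scale (of_real K) id)) p)
      = of_real (K * ((hnorm u)\<^sup>2 + (hnorm v)\<^sup>2)) + (?z + cnj ?z)"
    by (simp add: p mat_op_mat22 op_scale_def cinner_simps cinner_same algebra_simps)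
  have "- Re ?z \<le> hnorm u * hnorm (x v)"
    using Cauchy_Schwarz[of u "x v"] abs_Re_le_cmod[of ?z] by linarith
  also have "\<dots> \<le> hnorm u * (K * hnorm v)" by (intro mult_left_mono K) simp
  finally have "- 2 * Re ?z \<le> K * (2 * hnorm u * hnorm v)" by (simp only: mult_ac)
  moreover have "K * (2 * hnorm u * hnorm v) \<le> K * ((hnorm u)\<^sup>2 + (hnorm v)\<^sup>2)"
    by (intro mult_left_mono sum_squares_bound K)
  ultimately have "0 \<le> K * ((hnorm u)\<^sup>2 + (hnorm v)\<^sup>2) + 2 * Re ?z" by linarith
  then show "Im (cinner p (mat_op (mat22 (op_scale (of_real K) id) x (adj x) (op_scale (of_real K) id)) p)) = 0 \<and>
      0 \<le> Re (cinner p (mat_op (mat22 (op_scale (of_real K) id) x (adj x) (op_scale (of_real K) id)) p))"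
    unfolding z by simp
qed

text \<open>The quadratic form at \<open>(u, v)\<close> is the squared norm of
  \<open>u + x v\<close>. The image of this matrix yields the Schwarz inequality.\<close>

lemma positive_mat_gram:
  assumes b: "bounded_op x"
  shows "positive_op (mat_op (mat22 id x (adj x) (adj x \<circ> x)))"
  unfolding positive_op_def
proof (rule allI)
  fix p :: "'a \<times> 'a"
  obtain u v where p: "p = (u, v)" by (cases p)
  have "cinner p (mat_op (mat22 id x (adj x) (adj x \<circ> x)) p) = cinner (u + x v) (u + x v)"
    by (simp add: p mat_op_mat22 cinner_simps cinner_adj[OF b, symmetric])
  then show "Im (cinner p (mat_op (mat22 id x (adj x) (adj x \<circ> x)) p)) = 0 \<and>
      0 \<le> Re (cinner p (mat_op (mat22 id x (adj x) (adj x \<circ> x)) p))"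
    by (simp add: cinner_pos)
qed

subsection \<open>Unital star homomorphisms preserve positive contractions\<close>

lemma vna_mat_mult:
  "von_neumann_algebra M \<Longrightarrow> (\<And>i j. A i j \<in> M) \<Longrightarrow> (\<And>i j. B i j \<in> M) \<Longrightarrow> mat_mult A B i j \<in> M"
  by (simp add: mat_mult_def vna_add vna_comp)

lemma vna_mat_id: "von_neumann_algebra M \<Longrightarrow> mat_id i j \<in> M"
  by (simp add: mat_id_def vna_zero vna_id)

lemma vna_mat_add:
  "von_neumann_algebra M \<Longrightarrow> (\<And>i j. A i j \<in> M) \<Longrightarrow> (\<And>i j. B i j \<in> M) \<Longrightarrow> mat_add A B i j \<in> M"
  by (simp add: mat_add_def vna_add)

lemma vna_mat_scale: "von_neumann_algebra M \<Longrightarrow> (\<And>i j. A i j \<in> M) \<Longrightarrow> mat_scale c A i j \<in> M"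
  by (simp add: mat_scale_def vna_scale)

text \<open>Horner form of the sum of \<open>r^(k+1) C^k\<close> over \<open>k < n\<close>, a
  partial sum of the series for the inverse of \<open>1/r - C\<close>.\<close>

primrec neumann :: "complex \<Rightarrow> 'a::chilbert mat2 \<Rightarrow> nat \<Rightarrow> 'a mat2" where
  "neumann r C 0 = (\<lambda>i j. op_zero)"
| "neumann r C (Suc n) = mat_scale r (mat_add mat_id (mat_mult (neumann r C n) C))"

lemma vna_neumann:
  "von_neumann_algebra M \<Longrightarrow> (\<And>i j. C i j \<in> M) \<Longrightarrow> neumann r C n i j \<in> M"
  by (induction n arbitrary: i j) (simp_all add: vna_zero vna_mat_scale vna_mat_add vna_mat_id vna_mat_mult)

lemma mat_op_weak_limit:
  assumes "\<And>i j. weak_limit U (\<lambda>n. A n i j) (G i j)"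
  shows "weak_limit U (\<lambda>n. mat_op (A n)) (mat_op G)"
  unfolding weak_limit_def
proof (intro allI)
  fix p q :: "'a \<times> 'a"
  obtain a b c d where pq: "p = (a, b)" "q = (c, d)" by (cases p; cases q)
  have l: "((\<lambda>n. cinner x (A n i j y)) \<longlongrightarrow> cinner x (G i j y)) U" for i j x y
    using assms by (simp add: weak_limit_def)
  show "((\<lambda>n. cinner p (mat_op (A n) q)) \<longlongrightarrow> cinner p (mat_op G q)) U"
    unfolding pq mat_op_def fst_conv snd_conv cinner_Pair cinner_add_right
    by (intro tendsto_add l)
qed

text \<open>The Neumann series of \<open>A + t = (1 + t) - (1 - A)\<close> converges because \<open>1 - A\<close> is a contraction;
  a weak ultralimit of its partial sums has entries in \<open>M\<close>.\<close>

lemma X_set_resolvent: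
  fixes t :: real
  assumes v: "von_neumann_algebra M" and A: "A \<in> X_set M" and t: "t > 0"
  obtains G where "\<And>i j. G i j \<in> M" "mat_mult G (mat_add A (mat_scale (of_real t) mat_id)) = mat_id"
proof -
  obtain U where U: "ultra U" "U \<le> sequentially" using ultra_exists .
  have nb: "U \<noteq> bot" using U(1) by (simp add: ultra_def)
  define a where "a = mat_op A"
  have AM: "A i j \<in> M" for i j using A by (rule X_set_mem)
  define C where "C = mat_add mat_id (mat_scale (-1) A)"
  have CM: "C i j \<in> M" for i j
    unfolding C_def by (intro vna_mat_add vna_mat_scale vna_mat_id v AM)
  \<comment> \<open>Chosen so that \<open>A + t\<close> equals \<open>1/r - C\<close>.\<close>
  define r where "r = 1 / (1 + t)"
  have r: "0 < r" "r < 1" using t by (auto simp: r_def)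
  have ba: "bounded_op a" unfolding a_def by (intro bounded_op_mat_op vna_bounded_op[OF v] AM)
  have c: "mat_op C = op_diff id a"
    by (simp add: C_def mat_op_mat_add mat_op_mat_id mat_op_mat_scale op_diff_eq a_def)
  have cp: "mat_op C p = p - a p" for p by (simp add: c op_diff_def)
  have bc: "bounded_op (mat_op C)" by (simp add: c bounded_op_op_diff bounded_op_id ba)
  have c_le: "hnorm (mat_op C p) \<le> hnorm p" for p
  proof (rule positive_le_id_contraction[OF bc])
    show "positive_op (mat_op C)" "positive_op (op_diff id (mat_op C))"
      using A unfolding c X_set_iff[OF v] a_def by (simp_all add: op_diff_def)
  qed
  define g where "g n = mat_op (neumann (of_real r) C n)" for n
  have gM: "neumann (of_real r) C n i j \<in> M" for n i j by (rule vna_neumann[OF v CM])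
  have bg: "bounded_op (g n)" for n unfolding g_def by (intro bounded_op_mat_op vna_bounded_op[OF v] gM)
  have g0: "g 0 p = 0" for p by (simp add: g_def mat_op_def op_zero_def zero_prod_def)
  have gS: "g (Suc n) p = hscale (of_real r) (p + g n (mat_op C p))" for n p
    by (simp add: g_def mat_op_mat_scale mat_op_mat_add mat_op_mat_id mat_op_mat_mult[OF vna_bounded_op[OF v gM]]
        op_scale_def op_add_def)
  \<comment> \<open>\<open>1 / t\<close> solves \<open>k = r * (1 + k)\<close>, so the bound
    reproduces itself under the recursion.\<close>
  have bound: "hnorm (g n p) \<le> (1 / t) * hnorm p" for n p
  proof (induction n arbitrary: p)
    case 0
    then show ?case using t by (simp add: g0)
  next
    case (Suc n)
    have "hnorm (g (Suc n) p) = r * hnorm (p + g n (mat_op C p))"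
      using r by (simp add: gS hnorm_hscale)
    also have "\<dots> \<le> r * (hnorm p + (1 / t) * hnorm p)"
    proof (rule mult_left_mono)
      have "hnorm (g n (mat_op C p)) \<le> (1 / t) * hnorm (mat_op C p)" by (rule Suc.IH)
      also have "\<dots> \<le> (1 / t) * hnorm p" using t by (intro mult_left_mono c_le) simp
      finally show "hnorm (p + g n (mat_op C p)) \<le> hnorm p + (1 / t) * hnorm p"
        using hnorm_triangle[of p "g n (mat_op C p)"] by linarith
    qed (use r in simp)
    also have "\<dots> = (r * (1 + 1 / t)) * hnorm p" by (simp only: distrib_left distrib_right mult.assoc mult_1_left mult_1_right)
    also have "r * (1 + 1 / t) = 1 / t" using t by (simp add: r_def field_simps)
    finally show ?case .
  qed
  define b where "b p = a p + hscale (of_real t) p" for p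
  have cb: "mat_op C (b p) = b (mat_op C p)" for p
    by (simp add: cp b_def bounded_op_add[OF ba] bounded_op_diff[OF ba] bounded_op_hscale[OF ba] hscale_diff_right)
  have rb: "hscale (of_real r) (b p) = p - hscale (of_real r) (mat_op C p)" for p
  proof -
    have "b p + mat_op C p = hscale 1 p + hscale (of_real t) p" by (simp add: b_def cp hscale_one)
    also have "\<dots> = hscale (of_real (1 + t)) p" by (simp add: hscale_add_left)
    finally have "hscale (of_real r) (b p + mat_op C p) = hscale (of_real (r * (1 + t))) p"
      by (simp add: hscale_hscale)
    also have "r * (1 + t) = 1" using t by (simp add: r_def)
    finally show ?thesis by (simp add: hscale_add_right hscale_one eq_diff_eq)
  qed
  \<comment> \<open>Telescoping: \<open>q\<close> is \<open>r^n C^n p\<close>, small because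
    \<open>C\<close> is a contraction and \<open>r < 1\<close>.\<close>
  have err: "\<exists>q. g n (b p) = p - q \<and> hnorm q \<le> r ^ n * hnorm p" for n p
  proof (induction n arbitrary: p)
    case 0
    then show ?case by (intro exI[of _ p]) (simp add: g0)
  next
    case (Suc n)
    obtain q where q: "g n (b (mat_op C p)) = mat_op C p - q" "hnorm q \<le> r ^ n * hnorm (mat_op C p)"
      using Suc.IH by blast
    have "g (Suc n) (b p) = p - hscale (of_real r) q"
      by (simp add: gS cb q(1) hscale_add_right hscale_diff_right rb)
    moreover have "hnorm (hscale (of_real r) q) \<le> r ^ Suc n * hnorm p"
    proof -
      have "hnorm q \<le> r ^ n * hnorm p"
        using q(2) mult_left_mono[OF c_le[of p], of "r ^ n"] r by (meson order_trans zero_le_power less_imp_le)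
      then show ?thesis using r by (simp add: hnorm_hscale mult.assoc mult_left_mono)
    qed
    ultimately show ?case by blast
  qed
  have ex: "\<exists>S. S \<in> M \<and> weak_limit U (\<lambda>n. neumann (of_real r) C n i j) S" for i j
  proof -
    have le: "hnorm (neumann (of_real r) C n i j x) \<le> (1 / t) * hnorm x" for n x
      using mat_entry_le[OF vna_bounded_op[OF v gM] bound[unfolded g_def]] .
    have t0: "1 / t \<ge> 0" using t by simp
    show ?thesis
      by (rule weak_limit_exists[OF U(1) vna_bounded_op[OF v gM] le t0])
        (intro exI conjI vna_weak_limit[OF v U(1) gM])
  qed
  define G where "G i j = (SOME S. S \<in> M \<and> weak_limit U (\<lambda>n. neumann (of_real r) C n i j) S)" for i j
  have G: "G i j \<in> M" "weak_limit U (\<lambda>n. neumann (of_real r) C n i j) (G i j)" for i j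
    using someI_ex[OF ex] unfolding G_def by blast+
  have lim: "((\<lambda>n. cinner w (g n p)) \<longlongrightarrow> cinner w (mat_op G p)) U" for w p
  proof -
    have "weak_limit U (\<lambda>n. mat_op (neumann (of_real r) C n)) (mat_op G)"
      by (rule mat_op_weak_limit) (rule G(2))
    then show ?thesis unfolding weak_limit_def g_def by blast
  qed
  have Gb: "mat_op G (b p) = p" for p
  proof (rule cinner_ext_right)
    fix w
    \<comment> \<open>The error is geometric in \<open>n\<close>, hence vanishes along
      \<open>U\<close> because \<open>U\<close> lies below \<open>sequentially\<close>.\<close>
    have "((\<lambda>n. cinner w (g n (b p)) - cinner w p) \<longlongrightarrow> 0) U"
    proof (rule Lim_null_comparison)
      show "eventually (\<lambda>n. norm (cinner w (g n (b p)) - cinner w p) \<le> hnorm w * (r ^ n * hnorm p)) U"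
      proof (rule always_eventually, rule allI)
        fix n
        obtain q where q: "g n (b p) = p - q" "hnorm q \<le> r ^ n * hnorm p" using err by blast
        have "norm (cinner w (g n (b p)) - cinner w p) = cmod (cinner w q)"
          by (simp add: q(1) cinner_simps)
        also have "\<dots> \<le> hnorm w * hnorm q" by (rule Cauchy_Schwarz)
        also have "\<dots> \<le> hnorm w * (r ^ n * hnorm p)" by (intro mult_left_mono q(2)) simp
        finally show "norm (cinner w (g n (b p)) - cinner w p) \<le> hnorm w * (r ^ n * hnorm p)" .
      qed
      have "(\<lambda>n. hnorm w * (r ^ n * hnorm p)) \<longlonglongrightarrow> hnorm w * (0 * hnorm p)"
        using r by (intro tendsto_intros LIMSEQ_power_zero) simp
      then show "((\<lambda>n. hnorm w * (r ^ n * hnorm p)) \<longlongrightarrow> 0) U"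
        using tendsto_mono[OF U(2)] by simp
    qed
    moreover have "((\<lambda>n. cinner w (g n (b p)) - cinner w p) \<longlongrightarrow> cinner w (mat_op G (b p)) - cinner w p) U"
      by (intro tendsto_intros lim)
    ultimately have "cinner w (mat_op G (b p)) - cinner w p = 0" by (rule tendsto_unique[OF nb, rotated])
    then show "cinner w (mat_op G (b p)) = cinner w p" by simp
  qed
  let ?B = "mat_add A (mat_scale (of_real t) mat_id)"
  have BM: "?B i j \<in> M" for i j by (intro vna_mat_add vna_mat_scale vna_mat_id v AM)
  have "mat_op ?B = b"
    by (simp add: fun_eq_iff mat_op_mat_add mat_op_mat_scale mat_op_mat_id op_add_def op_scale_def b_def a_def)
  then have "mat_op (mat_mult G ?B) = mat_op mat_id"
    by (simp add: mat_op_mat_mult[OF vna_bounded_op[OF v G(1)]] mat_op_mat_id fun_eq_iff Gb)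
  then have "mat_mult G ?B = mat_id"
    by (rule mat_op_inject[rotated 2])
      (intro vna_bounded_op[OF v] vna_mat_mult[OF v] vna_mat_id[OF v] G(1) BM)+
  then show ?thesis using that G(1) by blast
qed

text \<open>The left inverse of \<open>A + t\<close> has entries in \<open>M\<close>, so its
  entrywise image is a left inverse of the image of \<open>A\<close> plus \<open>t\<close> and
  bounds that operator below. Only algebraic identities cross over; no continuity of
  \<open>\<phi>\<close> is presupposed.\<close>

lemma star_hom_positive:
  assumes vM: "von_neumann_algebra M" and vN: "von_neumann_algebra N"
    and mem: "\<And>x. x \<in> M \<Longrightarrow> \<phi> x \<in> N"
    and add: "\<And>x y. x \<in> M \<Longrightarrow> y \<in> M \<Longrightarrow> \<phi> (op_add x y) = op_add (\<phi> x) (\<phi> y)"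
    and comp: "\<And>x y. x \<in> M \<Longrightarrow> y \<in> M \<Longrightarrow> \<phi> (x \<circ> y) = \<phi> x \<circ> \<phi> y"
    and scale: "\<And>c x. x \<in> M \<Longrightarrow> \<phi> (op_scale c x) = op_scale c (\<phi> x)"
    and adj: "\<And>x. x \<in> M \<Longrightarrow> \<phi> (adj x) = adj (\<phi> x)"
    and unit: "\<phi> id = id"
    and A: "A \<in> X_set M"
  shows "positive_op (mat_op (\<lambda>i j. \<phi> (A i j)))"
proof (rule positive_op_of_resolvents)
  have AM: "A i j \<in> M" for i j using A by (rule X_set_mem)
  have b: "bounded_op (\<phi> (A i j))" for i j by (intro vna_bounded_op[OF vN] mem AM)
  then show "bounded_op (mat_op (\<lambda>i j. \<phi> (A i j)))" by (rule bounded_op_mat_op)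
  have bA: "bounded_op (mat_op A)" by (intro bounded_op_mat_op vna_bounded_op[OF vM] AM)
  have "adj (A i j) = A j i" for i j
    using A by (intro mat_op_hermitian_imp vna_bounded_op[OF vM] AM positive_op_hermitian bA)
      (simp add: X_set_iff_contraction)
  then have "adj (\<phi> (A i j)) = \<phi> (A j i)" for i j by (simp add: adj[OF AM, symmetric])
  then show "cinner (mat_op (\<lambda>i j. \<phi> (A i j)) p) q = cinner p (mat_op (\<lambda>i j. \<phi> (A i j)) q)" for p q
    by (rule mat_op_hermitianI[OF b])
  have zero: "\<phi> op_zero = op_zero"
    using scale[OF vna_id[OF vM], of 0] by (simp add: op_scale_def op_zero_def)
  have mid: "\<phi> (mat_id i j) = mat_id i j" for i j by (simp add: mat_id_def unit zero)
  fix t :: real assume t: "t > 0"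
  let ?B = "mat_add A (mat_scale (of_real t) mat_id)"
  obtain G where GM: "\<And>i j. G i j \<in> M" and G: "mat_mult G ?B = mat_id"
    using X_set_resolvent[OF vM A t] by metis
  have BM: "?B i j \<in> M" for i j by (intro vna_mat_add vna_mat_scale vna_mat_id vM AM)
  have B: "\<phi> (?B i j) = mat_add (\<lambda>i j. \<phi> (A i j)) (mat_scale (of_real t) mat_id) i j" for i j
    by (simp add: mat_add_def mat_scale_def add scale AM vna_mat_id[OF vM] vna_scale[OF vM] mid)
  have bG: "bounded_op (\<phi> (G i j))" for i j by (intro vna_bounded_op[OF vN] mem GM)
  have "mat_mult (\<lambda>i j. \<phi> (G i j)) (\<lambda>i j. \<phi> (?B i j)) i j = \<phi> (mat_mult G ?B i j)" for i j
    by (simp add: mat_mult_def add comp GM BM vna_comp[OF vM])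
  then have "mat_mult (\<lambda>i j. \<phi> (G i j)) (\<lambda>i j. \<phi> (?B i j)) = mat_id"
    by (simp add: G mid fun_eq_iff)
  then have "mat_op (\<lambda>i j. \<phi> (G i j)) \<circ> mat_op (\<lambda>i j. \<phi> (?B i j)) = id"
    by (metis mat_op_mat_mult[of "\<lambda>i j. \<phi> (G i j)", OF bG] mat_op_mat_id)
  moreover have "mat_op (\<lambda>i j. \<phi> (?B i j)) p = mat_op (\<lambda>i j. \<phi> (A i j)) p + hscale (of_real t) p" for p
    unfolding B by (simp add: mat_op_mat_add mat_op_mat_scale mat_op_mat_id op_add_def op_scale_def)
  ultimately have eq: "mat_op (\<lambda>i j. \<phi> (G i j)) (mat_op (\<lambda>i j. \<phi> (A i j)) p + hscale (of_real t) p) = p" for p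
    by (metis comp_apply id_apply)
  obtain K where K: "\<And>p. hnorm (mat_op (\<lambda>i j. \<phi> (G i j)) p) \<le> K * hnorm p"
    using bounded_op_bound[OF bounded_op_mat_op[of "\<lambda>i j. \<phi> (G i j)", OF bG]] by metis
  show "\<exists>K. \<forall>p. hnorm p \<le> K * hnorm (mat_op (\<lambda>i j. \<phi> (A i j)) p + hscale (of_real t) p)"
    using K[of "mat_op (\<lambda>i j. \<phi> (A i j)) p + hscale (of_real t) p" for p, unfolded eq] by blast
qed

text \<open>Positivity is transported for \<open>A\<close> and for \<open>1 - A\<close>; the second
  stands for the norm bound.\<close>

lemma star_hom_X_set:
  assumes vM: "von_neumann_algebra M" and vN: "von_neumann_algebra N"
    and mem: "\<And>x. x \<in> M \<Longrightarrow> \<phi> x \<in> N"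
    and add: "\<And>x y. x \<in> M \<Longrightarrow> y \<in> M \<Longrightarrow> \<phi> (op_add x y) = op_add (\<phi> x) (\<phi> y)"
    and comp: "\<And>x y. x \<in> M \<Longrightarrow> y \<in> M \<Longrightarrow> \<phi> (x \<circ> y) = \<phi> x \<circ> \<phi> y"
    and scale: "\<And>c x. x \<in> M \<Longrightarrow> \<phi> (op_scale c x) = op_scale c (\<phi> x)"
    and adj: "\<And>x. x \<in> M \<Longrightarrow> \<phi> (adj x) = adj (\<phi> x)"
    and unit: "\<phi> id = id"
    and A: "A \<in> X_set M"
  shows "(\<lambda>i j. \<phi> (A i j)) \<in> X_set N"
proof -
  have hom: "positive_op (mat_op (\<lambda>i j. \<phi> (B i j)))" if "B \<in> X_set M" for B
    by (rule star_hom_positive[OF vM vN _ _ _ _ _ _ that]) (fact mem add comp scale adj unit)+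
  have AM: "A i j \<in> M" for i j using A by (rule X_set_mem)
  have zero: "\<phi> op_zero = op_zero"
    using scale[OF vna_id[OF vM], of 0] by (simp add: op_scale_def op_zero_def)
  let ?C = "mat_add mat_id (mat_scale (-1) A)"
  have mC: "mat_op ?C = op_diff id (mat_op A)"
    by (simp add: mat_op_mat_add mat_op_mat_id mat_op_mat_scale op_diff_eq)
  have "?C i j \<in> M" for i j by (intro vna_mat_add vna_mat_scale vna_mat_id vM AM)
  then have "?C \<in> X_set M"
    using A unfolding X_set_iff[OF vM] mC by (simp add: op_diff_def)
  then have "positive_op (mat_op (\<lambda>i j. \<phi> (?C i j)))" by (rule hom)
  moreover have "(\<lambda>i j. \<phi> (?C i j)) = mat_add mat_id (mat_scale (-1) (\<lambda>i j. \<phi> (A i j)))"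
    by (simp add: fun_eq_iff mat_add_def mat_scale_def mat_id_def add scale AM
        vna_id[OF vM] vna_zero[OF vM] vna_scale[OF vM] unit zero)
  ultimately have "positive_op (op_diff id (mat_op (\<lambda>i j. \<phi> (A i j))))"
    by (simp add: mat_op_mat_add mat_op_mat_id mat_op_mat_scale op_diff_eq)
  then show ?thesis unfolding X_set_iff[OF vN] using hom[OF A] mem[OF AM] by simp
qed

subsection \<open>Relations matching positive contractions\<close>

text \<open>A relation, rather than a map, makes the converse an object of the same kind, so that
  each consequence becomes available in both directions. Totality is not postulated; it follows from
  \<open>R_X\<close>.\<close>

locale X_relation =
  fixes M :: "('a::chilbert \<Rightarrow> 'a) set" and N :: "('b::chilbert \<Rightarrow> 'b) set"
    and R :: "('a \<Rightarrow> 'a) \<Rightarrow> ('b \<Rightarrow> 'b) \<Rightarrow> bool"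
  assumes vM: "von_neumann_algebra M" and vN: "von_neumann_algebra N"
    and R_mem: "R x y \<Longrightarrow> x \<in> M \<and> y \<in> N"
    and R_add: "R x y \<Longrightarrow> R x' y' \<Longrightarrow> R (op_add x x') (op_add y y')"
    and R_scale: "R x y \<Longrightarrow> R (op_scale c x) (op_scale c y)"
    and R_unique: "R x y \<Longrightarrow> R x y' \<Longrightarrow> y = y'"
    and R_X: "A \<in> X_set M \<Longrightarrow> \<exists>B\<in>X_set N. \<forall>i j. R (A i j) (B i j)"
begin

lemmas M_bounded = vna_bounded_op[OF vM] and N_bounded = vna_bounded_op[OF vN]

lemma R_diff: "R x y \<Longrightarrow> R x' y' \<Longrightarrow> R (op_diff x x') (op_diff y y')"
  unfolding op_diff_eq by (intro R_add R_scale)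

lemma R_unscale:
  assumes "R (op_scale c x) y" "c \<noteq> 0" shows "R x (op_scale (inverse c) y)"
proof -
  have "op_scale (inverse c) (op_scale c x) = x"
    using assms(2) by (simp add: op_scale_def hscale_hscale hscale_one)
  then show ?thesis using R_scale[OF assms(1), of "inverse c"] by simp
qed

text \<open>\<open>R_X\<close> concerns only positive contractions, so \<open>x\<close> is placed in
  the off-diagonal corner of a positive matrix, scaled into \<open>X_set M\<close>, and its partner
  is scaled back.\<close>

lemma R_total: assumes x: "x \<in> M" obtains y where "R x y"
proof -
  obtain K where K: "K > 0" "\<And>v. hnorm (x v) \<le> K * hnorm v"
    using bounded_op_bound[OF M_bounded[OF x]] by metis
  let ?D = "mat22 (op_scale (of_real K) id) x (adj x) (op_scale (of_real K) id)"
  have "positive_op (mat_op ?D)"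
    using K by (intro positive_mat_dilation M_bounded x) auto
  moreover have "?D i j \<in> M" for i j
    by (cases i; cases j) (simp_all add: vna_scale[OF vM] vna_id[OF vM] vna_adj[OF vM] x)
  ultimately obtain s where s: "s > 0" "mat_scale (of_real s) ?D \<in> X_set M"
    using positive_mat_scaled_in_X_set[OF vM] by metis
  from R_X[OF s(2)] obtain B where "R (mat_scale (of_real s) ?D False True) (B False True)" by blast
  then have "R (op_scale (of_real s) x) (B False True)" by (simp add: mat_scale_def)
  from R_unscale[OF this] s(1) that show ?thesis by auto
qed

lemma R_zero: "R op_zero op_zero"
proof -
  obtain y where "R id y" using R_total[OF vna_id[OF vM]] .
  from R_scale[OF this, of 0] show ?thesis by (simp add: op_scale_def op_zero_def)
qed

text \<open>Some positive multiple of \<open>A\<close> lies in \<open>X_set M\<close>; uniqueness of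
  partners identifies its match in \<open>X_set N\<close> with the same multiple of
  \<open>B\<close>.\<close>

lemma R_positive_mat:
  assumes p: "positive_op (mat_op A)" and AB: "\<And>i j. R (A i j) (B i j)"
  shows "positive_op (mat_op B)"
proof -
  have AM: "A i j \<in> M" for i j using R_mem[OF AB] by blast
  obtain s where s: "s > 0" "mat_scale (of_real s) A \<in> X_set M"
    using positive_mat_scaled_in_X_set[OF vM AM p] by metis
  obtain B' where B': "B' \<in> X_set N" "\<And>i j. R (mat_scale (of_real s) A i j) (B' i j)"
    using R_X[OF s(2)] by blast
  have "B' i j = mat_scale (of_real s) B i j" for i j
    using R_unique[OF B'(2)] R_scale[OF AB] by (simp add: mat_scale_def)
  then have "B' = mat_scale (of_real s) B" by blast
  then have "positive_op (mat_op (mat_scale (of_real s) B))"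
    using B'(1) by (simp add: X_set_iff_contraction)
  then have "positive_op (op_scale (of_real (inverse s)) (op_scale (of_real s) (mat_op B)))"
    unfolding mat_op_mat_scale by (rule positive_op_scale) (use s(1) in simp)
  moreover have "op_scale (of_real (inverse s)) (op_scale (of_real s) (mat_op B)) = mat_op B"
    using s(1) by (simp add: op_scale_def hscale_hscale hscale_one flip: of_real_mult)
  ultimately show ?thesis by simp
qed

lemma R_positive_mat22:
  assumes "positive_op (mat_op (mat22 a b c d))" "R a a'" "R b b'" "R c c'" "R d d'"
  shows "positive_op (mat_op (mat22 a' b' c' d'))"
proof (rule R_positive_mat[OF assms(1)])
  show "R (mat22 a b c d i j) (mat22 a' b' c' d' i j)" for i j
    using assms by (cases i; cases j) simp_all
qed

lemma R_positive:
  assumes xy: "R x y" and p: "positive_op x"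
  shows "positive_op y"
proof -
  have "positive_op (mat_op (mat22 x op_zero op_zero op_zero))"
    using p by (auto simp: positive_op_def mat_op_def op_zero_def cinner_prod_def)
  from R_positive_mat22[OF this xy R_zero R_zero R_zero]
  have "positive_op (mat_op (mat22 y op_zero op_zero op_zero))" .
  note * = this[unfolded positive_op_def, rule_format, of "(v, 0)" for v]
  show ?thesis unfolding positive_op_def
    using * by (simp add: mat_op_def op_zero_def cinner_prod_def)
qed

text \<open>The dilation of \<open>x\<close> goes to a positive, hence hermitian, matrix, whose
  off-diagonal corners are adjoint to each other. The image \<open>z\<close> of the scalar diagonal
  may be unknown, since unitality is not yet at hand.\<close>

lemma R_adj: assumes xy: "R x y" shows "R (adj x) (adj y)"
proof -
  have x: "x \<in> M" using R_mem[OF xy] by blast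
  obtain w where w: "R (adj x) w" using R_total[OF vna_adj[OF vM x]] .
  obtain K where K: "K > 0" "\<And>v. hnorm (x v) \<le> K * hnorm v"
    using bounded_op_bound[OF M_bounded[OF x]] by metis
  obtain z where z: "R (op_scale (of_real K) id) z"
    using R_total[OF vna_scale[OF vM vna_id[OF vM]]] .
  let ?B = "mat22 z y w z"
  have "positive_op (mat_op (mat22 (op_scale (of_real K) id) x (adj x) (op_scale (of_real K) id)))"
    using K by (intro positive_mat_dilation M_bounded x) auto
  from R_positive_mat22[OF this z xy w z] have p: "positive_op (mat_op ?B)" .
  have b: "bounded_op (?B i j)" for i j
    using R_mem[OF z] R_mem[OF xy] R_mem[OF w] N_bounded by (cases i; cases j) simp_all
  have "adj (?B False True) = ?B True False"
    by (rule mat_op_hermitian_imp[OF b positive_op_hermitian[OF bounded_op_mat_op[OF b] p]])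
  then show ?thesis using w by simp
qed

text \<open>The diagonal matrix with entries \<open>id\<close> and zero is a positive contraction,
  so its match is at most the identity, and so is the corner of that match. This is half of
  unitality; the other half comes from the converse relation.\<close>

lemma R_id_le: assumes "R id y" shows "positive_op (op_diff id y)"
proof -
  let ?A = "mat22 id op_zero op_zero op_zero :: 'a mat2"
  have m: "mat_op ?A p = (fst p, 0)" for p by (simp add: mat_op_def op_zero_def)
  have "?A i j \<in> M" for i j
    by (cases i; cases j) (simp_all add: vna_id[OF vM] vna_zero[OF vM])
  moreover have "positive_op (mat_op ?A)"
    by (simp add: positive_op_def m cinner_prod_def cinner_pos)
  moreover have "hnorm (mat_op ?A p) \<le> hnorm p" for p
    unfolding m by (cases p, rule power2_le_imp_le) (simp_all add: hnorm_Pair_sq)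
  ultimately have "?A \<in> X_set M" unfolding X_set_iff_contraction by blast
  then obtain B where B: "B \<in> X_set N" "R (?A False False) (B False False)" using R_X by blast
  have y: "B False False = y" using B(2) R_unique[OF assms] by simp
  have z': "B i True 0 = 0" for i by (rule bounded_op_zero[OF N_bounded[OF X_set_mem[OF B(1)]]])
  have "positive_op (op_diff id (mat_op B))" using B(1) X_set_iff[OF vN] by blast
  note * = this[unfolded positive_op_def, rule_format, of "(v, 0)" for v]
  show ?thesis unfolding positive_op_def
    using * by (simp add: mat_op_def op_diff_def y z' cinner_prod_def)
qed

text \<open>The Kadison-Schwarz inequality, obtained from positivity of the image of the Gram matrix
  of \<open>x\<close>.\<close>

lemma R_Schwarz:
  assumes one: "R id id" and xy: "R x y" and z: "R (adj x \<circ> x) z"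
  shows "positive_op (op_diff z (adj y \<circ> y))"
proof -
  have b: "bounded_op x" "bounded_op y" using R_mem[OF xy] M_bounded N_bounded by auto
  have p: "positive_op (mat_op (mat22 id y (adj y) z))"
    by (rule R_positive_mat22[OF positive_mat_gram[OF b(1)] one xy R_adj[OF xy] z])
  \<comment> \<open>For fixed \<open>v\<close> the first component \<open>- y v\<close> minimises
    the quadratic form, which leaves the Schur complement
    \<open>z - adj y \<circ> y\<close>.\<close>
  have "cinner (- y v, v) (mat_op (mat22 id y (adj y) z) (- y v, v)) = cinner v (op_diff z (adj y \<circ> y) v)" for v
  proof -
    have "adj y (- y v) = - adj y (y v)"
      using R_mem[OF R_adj[OF xy]] N_bounded bounded_op_minus by blast
    then show ?thesis by (simp add: mat_op_mat22 op_diff_def cinner_simps)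
  qed
  then show ?thesis using p unfolding positive_op_def by metis
qed

end

text \<open>A relation that matches positive contractions in both directions is unital, and the Schwarz
  inequality for it and for its converse forces multiplicativity.\<close>

locale X_birelation = X_relation M N R + converse: X_relation N M "\<lambda>y x. R x y"
  for M :: "('a::chilbert \<Rightarrow> 'a) set" and N :: "('b::chilbert \<Rightarrow> 'b) set" and R
begin

text \<open>The preimage \<open>x\<close> of \<open>id\<close> satisfies \<open>x \<le> id\<close>
  by the converse relation; applying \<open>R\<close> to \<open>id - x\<close> gives
  \<open>id \<le> y\<close>, the reverse of \<open>R_id_le\<close>.\<close>

lemma R_id: "R id id"
proof -
  obtain y where y: "R id y" using R_total[OF vna_id[OF vM]] .
  obtain x where x: "R x id" using converse.R_total[OF vna_id[OF vN]] .
  have "positive_op (op_diff id x)" by (rule converse.R_id_le[OF x])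
  from R_positive[OF R_diff[OF y x] this] have "positive_op (op_diff y id)" .
  with R_id_le[OF y] have "y = id"
    using positive_op_antisym[OF _ bounded_op_id] R_mem[OF y] N_bounded by blast
  with y show ?thesis by simp
qed

lemma R_square:
  assumes xy: "R x y" shows "R (adj x \<circ> x) (adj y \<circ> y)"
proof -
  have xM: "adj x \<circ> x \<in> M" and yN: "adj y \<circ> y \<in> N"
    using R_mem[OF xy] vna_comp[OF vM] vna_adj[OF vM] vna_comp[OF vN] vna_adj[OF vN] by blast+
  obtain z where z: "R (adj x \<circ> x) z" using R_total[OF xM] .
  obtain w where w: "R w (adj y \<circ> y)" using converse.R_total[OF yN] .
  \<comment> \<open>Schwarz for the converse bounds the preimage \<open>w\<close> of
    \<open>adj y \<circ> y\<close> from below; mapping the difference forward gives the inequality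
    opposite to the direct one.\<close>
  have "positive_op (op_diff w (adj x \<circ> x))" by (rule converse.R_Schwarz[OF R_id xy w])
  from R_positive[OF R_diff[OF w z] this] have "positive_op (op_diff (adj y \<circ> y) z)" .
  with R_Schwarz[OF R_id xy z] have "z = adj y \<circ> y"
    using positive_op_antisym R_mem[OF z] yN N_bounded by blast
  with z show ?thesis by simp
qed

end

text \<open>A summand of the polarization identity. The outer factor \<open>c\<close> makes all
  terms except \<open>adj z \<circ> x\<close> cancel in the sum over
  \<open>c = 1, -1, \<i>, -\<i>\<close>, which counts that term four times.\<close>

definition op_polar :: "('a::chilbert \<Rightarrow> 'a) \<Rightarrow> ('a \<Rightarrow> 'a) \<Rightarrow> complex \<Rightarrow> 'a \<Rightarrow> 'a" where
  "op_polar x z c = op_scale c (adj (op_add x (op_scale c z)) \<circ> op_add x (op_scale c z))"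

lemma cinner_op_polar:
  assumes "bounded_op x" "bounded_op z"
  shows "cinner v (op_polar x z c w) = c * cinner (x v + hscale c (z v)) (x w + hscale c (z w))"
proof -
  have "bounded_op (op_add x (op_scale c z))" by (intro bounded_op_op_add bounded_op_op_scale assms)
  from cinner_adj[OF this] show ?thesis
    by (simp add: op_polar_def op_scale_def op_add_def cinner_hscale_right)
qed

lemma op_polarization:
  assumes x: "bounded_op x" and z: "bounded_op z"
  shows "op_scale (1/4) (op_add (op_add (op_polar x z 1) (op_polar x z (-1)))
    (op_add (op_polar x z \<i>) (op_polar x z (-\<i>)))) = adj z \<circ> x"
proof (rule op_ext)
  fix v w
  show "cinner v (op_scale (1/4) (op_add (op_add (op_polar x z 1) (op_polar x z (-1)))
      (op_add (op_polar x z \<i>) (op_polar x z (-\<i>)))) w) = cinner v ((adj z \<circ> x) w)"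
    by (simp add: op_scale_def op_add_def cinner_op_polar[OF x z] cinner_simps cinner_adj[OF z, symmetric])
      (simp add: algebra_simps)
qed

context X_birelation
begin

lemma R_polar: assumes "R x y" "R x' y'" shows "R (op_polar x x' c) (op_polar y y' c)"
  unfolding op_polar_def by (intro R_scale R_square R_add assms)

lemma R_adj_comp: assumes "R x y" "R x' y'" shows "R (adj x' \<circ> x) (adj y' \<circ> y)"
proof -
  have b: "bounded_op x" "bounded_op x'" "bounded_op y" "bounded_op y'"
    using R_mem assms M_bounded N_bounded by blast+
  show ?thesis
    unfolding op_polarization[OF b(1,2), symmetric] op_polarization[OF b(3,4), symmetric]
    by (intro R_scale R_add R_polar assms)
qed

lemma R_comp: assumes "R x y" "R x' y'" shows "R (x \<circ> x') (y \<circ> y')"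
proof -
  have b: "bounded_op x" "bounded_op y" using R_mem assms M_bounded N_bounded by blast+
  have adj2: "adj (adj x) = x" if "bounded_op x" "bounded_op (adj x)" for x :: "'c::chilbert \<Rightarrow> 'c"
    by (rule adj_unique[OF that(2)]) (rule cinner_adj_left[OF that(1)])
  have "R (adj (adj x) \<circ> x') (adj (adj y) \<circ> y')" by (intro R_adj_comp R_adj assms)
  moreover have "bounded_op (adj x)" "bounded_op (adj y)"
    using R_mem[OF R_adj[OF assms(1)]] M_bounded N_bounded by blast+
  ultimately show ?thesis by (simp add: adj2 b)
qed

lemma LvNA_isoI:
  assumes iso: "\<And>x y. R x y \<Longrightarrow> LN y = LM x"
  shows "LvNA_iso M LM N LN"
proof -
  define \<phi> where "\<phi> x = (THE y. R x y)" for x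
  have phiI: "\<phi> x = y" if "R x y" for x y
    unfolding \<phi>_def using that R_unique by blast
  have phi: "R x (\<phi> x)" if "x \<in> M" for x
    using R_total[OF that] phiI by metis
  have inj: "inj_on \<phi> M" by (rule inj_onI) (metis phi converse.R_unique)
  have "\<phi> ` M = N"
  proof (rule set_eqI, rule iffI)
    fix y assume "y \<in> N"
    then obtain x where "R x y" using converse.R_total by metis
    then show "y \<in> \<phi> ` M" using phiI R_mem by blast
  qed (use phi R_mem in blast)
  with inj have "bij_betw \<phi> M N" by (simp add: bij_betw_def)
  then show ?thesis unfolding LvNA_iso_def
    by (intro exI[of _ \<phi>] conjI ballI allI phiI R_add R_comp R_scale R_adj iso phi)
qed

end

subsection \<open>Admissible seminorms and the Hausdorff distance\<close>

lemma admissible_nonneg: "L \<in> admissible M LM N LN \<Longrightarrow> x \<in> M \<Longrightarrow> y \<in> N \<Longrightarrow> 0 \<le> L (x, y)"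
  and admissible_scale: "L \<in> admissible M LM N LN \<Longrightarrow> x \<in> M \<Longrightarrow> y \<in> N \<Longrightarrow>
    L (op_scale c x, op_scale c y) = cmod c * L (x, y)"
  and admissible_add: "L \<in> admissible M LM N LN \<Longrightarrow> x \<in> M \<Longrightarrow> y \<in> N \<Longrightarrow> x' \<in> M \<Longrightarrow> y' \<in> N \<Longrightarrow>
    L (op_add x x', op_add y y') \<le> L (x, y) + L (x', y')"
  and admissible_left: "L \<in> admissible M LM N LN \<Longrightarrow> x \<in> M \<Longrightarrow> L (x, op_zero) = LM x"
  and admissible_right: "L \<in> admissible M LM N LN \<Longrightarrow> y \<in> N \<Longrightarrow> L (op_zero, y) = LN y"
  unfolding admissible_def by blast+

lemma admissibleI:
  assumes "\<And>x y. x \<in> M \<Longrightarrow> y \<in> N \<Longrightarrow> 0 \<le> L (x, y)"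
    and "\<And>c x y. x \<in> M \<Longrightarrow> y \<in> N \<Longrightarrow> L (op_scale c x, op_scale c y) = cmod c * L (x, y)"
    and "\<And>x y x' y'. x \<in> M \<Longrightarrow> y \<in> N \<Longrightarrow> x' \<in> M \<Longrightarrow> y' \<in> N \<Longrightarrow>
      L (op_add x x', op_add y y') \<le> L (x, y) + L (x', y')"
    and "\<And>x. x \<in> M \<Longrightarrow> L (x, op_zero) = LM x" "\<And>y. y \<in> N \<Longrightarrow> L (op_zero, y) = LN y"
  shows "L \<in> admissible M LM N LN"
  using assms unfolding admissible_def by auto

lemma op_neg_neg [simp]: "op_neg (op_neg x) = x"
  by (simp add: op_neg_def)

lemma op_neg_zero [simp]: "op_neg op_zero = op_zero"
  by (simp add: op_neg_def op_zero_def)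

lemma op_add_zero [simp]: "op_add x op_zero = x" "op_add op_zero x = x"
  by (simp_all add: op_add_def op_zero_def)

lemma op_add_neg [simp]: "op_add x (op_neg x) = op_zero" "op_add (op_neg x) x = op_zero"
  by (simp_all add: op_add_def op_neg_def op_zero_def)

lemma op_neg_add: "op_neg (op_add x y) = op_add (op_neg x) (op_neg y)"
  by (simp add: op_add_def op_neg_def)

lemma op_neg_scale: "op_neg (op_scale c x) = op_scale c (op_neg x)"
  by (simp add: op_scale_def op_neg_def hscale_minus_right)

lemma admissible_neg:
  "L \<in> admissible M LM N LN \<Longrightarrow> x \<in> M \<Longrightarrow> y \<in> N \<Longrightarrow> L (op_neg x, op_neg y) = L (x, y)"
  by (simp add: op_neg_eq admissible_scale)

text \<open>A real-valued substitute for the Hausdorff distance, implied by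
  \<open>dist_H < r\<close> and implying \<open>dist_H \<le> r\<close>; this suffices because the
  distance is itself an infimum.\<close>

definition X_close where
  "X_close L M N r \<longleftrightarrow>
     (\<forall>A\<in>X_set M. \<exists>B\<in>X_set N. \<forall>i j. L (A i j, op_neg (B i j)) \<le> (r::real)) \<and>
     (\<forall>B\<in>X_set N. \<exists>A\<in>X_set M. \<forall>i j. L (A i j, op_neg (B i j)) \<le> r)"

lemma L_mat2_le_iff: "L_mat2 L A B \<le> r \<longleftrightarrow> (\<forall>i j. L (A i j, B i j) \<le> r)"
proof -
  have "L_mat2 L A B \<le> r \<longleftrightarrow> (\<forall>a\<in>(\<lambda>(i, j). L (A i j, B i j)) ` UNIV. a \<le> r)"
    unfolding L_mat2_def by (rule Max_le_iff) auto
  then show ?thesis by auto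
qed

lemma SUP_INF_less:
  fixes f :: "'i \<Rightarrow> 'j \<Rightarrow> real"
  assumes less: "(SUP a\<in>S. INF b\<in>T. ereal (f a b)) < ereal r" and a: "a \<in> S"
  shows "\<exists>b\<in>T. f a b < r"
proof -
  have "(INF b\<in>T. ereal (f a b)) \<le> (SUP a\<in>S. INF b\<in>T. ereal (f a b))"
    by (rule SUP_upper[OF a])
  then have "(INF b\<in>T. ereal (f a b)) < ereal r" using less by (rule le_less_trans)
  then show ?thesis by (simp add: INF_less_iff)
qed

lemma X_close_of_dist_H_less:
  assumes "dist_H L M N < ereal r" shows "X_close L M N r"
proof -
  have less: "(SUP A\<in>X_set M. INF B\<in>X_set N. ereal (L_mat2 L A (\<lambda>i j. op_neg (B i j)))) < ereal r"
    "(SUP B\<in>X_set N. INF A\<in>X_set M. ereal (L_mat2 L A (\<lambda>i j. op_neg (B i j)))) < ereal r"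
    using assms unfolding dist_H_def by simp_all
  have "\<forall>i j. L (A i j, op_neg (B i j)) \<le> r" if "L_mat2 L A (\<lambda>i j. op_neg (B i j)) < r" for A B
    using that L_mat2_le_iff[of L A "\<lambda>i j. op_neg (B i j)" r] by simp
  then show ?thesis unfolding X_close_def
    using SUP_INF_less[OF less(1)] SUP_INF_less[OF less(2)] by blast
qed

lemma dist_H_le_of_X_close: "X_close L M N r \<Longrightarrow> dist_H L M N \<le> ereal r"
proof -
  assume c: "X_close L M N r"
  have "(SUP A\<in>X_set M. INF B\<in>X_set N. ereal (L_mat2 L A (\<lambda>i j. op_neg (B i j)))) \<le> ereal r"
  proof (rule SUP_least)
    fix A assume "A \<in> X_set M"
    then obtain B where "B \<in> X_set N" "L_mat2 L A (\<lambda>i j. op_neg (B i j)) \<le> r"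
      using c unfolding X_close_def L_mat2_le_iff by blast
    then show "(INF B\<in>X_set N. ereal (L_mat2 L A (\<lambda>i j. op_neg (B i j)))) \<le> ereal r"
      by (intro INF_lower2[of B]) auto
  qed
  moreover have "(SUP B\<in>X_set N. INF A\<in>X_set M. ereal (L_mat2 L A (\<lambda>i j. op_neg (B i j)))) \<le> ereal r"
  proof (rule SUP_least)
    fix B assume "B \<in> X_set N"
    then obtain A where "A \<in> X_set M" "L_mat2 L A (\<lambda>i j. op_neg (B i j)) \<le> r"
      using c unfolding X_close_def L_mat2_le_iff by blast
    then show "(INF A\<in>X_set M. ereal (L_mat2 L A (\<lambda>i j. op_neg (B i j)))) \<le> ereal r"
      by (intro INF_lower2[of A]) auto
  qed
  ultimately show ?thesis by (simp add: dist_H_def)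
qed

lemma dist_qGH_lessE:
  assumes "dist_qGH M LM N LN < ereal r"
  obtains L where "L \<in> admissible M LM N LN" "X_close L M N r"
  using assms X_close_of_dist_H_less unfolding dist_qGH_def INF_less_iff by blast

lemma dist_qGH_le:
  "L \<in> admissible M LM N LN \<Longrightarrow> X_close L M N r \<Longrightarrow> dist_qGH M LM N LN \<le> ereal r"
  unfolding dist_qGH_def by (blast intro: INF_lower2 dist_H_le_of_X_close)

text \<open>An empty supremum in \<open>ereal\<close> is \<open>-\<infinity>\<close>, so a member of
  \<open>X_set M\<close> has to be exhibited; the zero matrix serves.\<close>

lemma dist_qGH_nonneg:
  assumes vM: "von_neumann_algebra M" and vN: "von_neumann_algebra N"
  shows "0 \<le> dist_qGH M LM N LN"
  unfolding dist_qGH_def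
proof (rule INF_greatest)
  fix L assume L: "L \<in> admissible M LM N LN"
  have "0 \<le> L_mat2 L (\<lambda>i j. op_zero) (\<lambda>i j. op_neg (B i j))" if "B \<in> X_set N" for B
  proof -
    have "0 \<le> L (op_zero, op_neg (B True True))"
      by (rule admissible_nonneg[OF L vna_zero[OF vM] vna_neg[OF vN X_set_mem[OF that]]])
    also have "\<dots> \<le> L_mat2 L (\<lambda>i j. op_zero) (\<lambda>i j. op_neg (B i j))"
      using L_mat2_le_iff[of L "\<lambda>i j. op_zero" "\<lambda>i j. op_neg (B i j)"] by blast
    finally show ?thesis .
  qed
  then have "0 \<le> (INF B\<in>X_set N. ereal (L_mat2 L (\<lambda>i j. op_zero) (\<lambda>i j. op_neg (B i j))))"
    by (intro INF_greatest) simp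
  also have "\<dots> \<le> (SUP A\<in>X_set M. INF B\<in>X_set N. ereal (L_mat2 L A (\<lambda>i j. op_neg (B i j))))"
    by (rule SUP_upper[OF zero_in_X_set[OF vM]])
  also have "\<dots> \<le> dist_H L M N" by (simp add: dist_H_def)
  finally show "0 \<le> dist_H L M N" .
qed

lemma ereal_le_of_real_bounds:
  fixes a b :: ereal
  assumes "\<And>r::real. b < ereal r \<Longrightarrow> a \<le> ereal r" shows "a \<le> b"
  using assms ereal_dense2[of b a] by (meson not_less)

text \<open>For the sum of the two norms every positive contraction is within a fixed distance of
  the zero matrix, because each norm is bounded on its unit ball.\<close>

lemma dist_qGH_finite:
  assumes LM: "LvNA M LM" and LN: "LvNA N LN"
  shows "dist_qGH M LM N LN < \<infinity>"
proof -
  note vM = LvNA_vna[OF LM] and vN = LvNA_vna[OF LN]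
  define L where "L = (\<lambda>(x, y). LM x + LN y)"
  have z: "LM op_zero = 0" "LN op_zero = 0"
    using LvNA_eq_0[OF LM vna_zero[OF vM]] LvNA_eq_0[OF LN vna_zero[OF vN]] by auto
  have L: "L \<in> admissible M LM N LN"
  proof (rule admissibleI)
    fix x y x' y' assume "x \<in> M" "y \<in> N" "x' \<in> M" "y' \<in> N"
    then show "L (op_add x x', op_add y y') \<le> L (x, y) + L (x', y')"
      using LvNA_add[OF LM, of x x'] LvNA_add[OF LN, of y y'] by (simp add: L_def)
  qed (simp_all add: L_def z LvNA_nonneg[OF LM] LvNA_nonneg[OF LN] LvNA_scale[OF LM] LvNA_scale[OF LN] distrib_left)
  obtain C where C: "C \<ge> 0" "\<And>x. x \<in> M \<Longrightarrow> (\<And>v. hnorm (x v) \<le> hnorm v) \<Longrightarrow> LM x \<le> C"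
    using LvNA_bounded_on_ball[OF LM] by metis
  obtain D where D: "D \<ge> 0" "\<And>x. x \<in> N \<Longrightarrow> (\<And>v. hnorm (x v) \<le> hnorm v) \<Longrightarrow> LN x \<le> D"
    using LvNA_bounded_on_ball[OF LN] by metis
  have "X_close L M N (C + D)" unfolding X_close_def
  proof (intro conjI ballI)
    fix A assume A: "A \<in> X_set M"
    have "L (A i j, op_neg op_zero) \<le> C + D" for i j
      using C(2)[OF X_set_mem[OF A] X_set_entry_le[OF vM A], of i j] D(1) by (simp add: L_def z)
    then show "\<exists>B\<in>X_set N. \<forall>i j. L (A i j, op_neg (B i j)) \<le> C + D"
      by (intro bexI[OF _ zero_in_X_set[OF vN]]) simp
  next
    fix B assume B: "B \<in> X_set N"
    have "LN (op_neg (B i j)) = LN (B i j)" for i j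
      by (simp add: op_neg_eq LvNA_scale[OF LN X_set_mem[OF B]])
    then have "L (op_zero, op_neg (B i j)) \<le> C + D" for i j
      using D(2)[OF X_set_mem[OF B] X_set_entry_le[OF vN B], of i j] C(1) by (simp add: L_def z)
    then show "\<exists>A\<in>X_set M. \<forall>i j. L (A i j, op_neg (B i j)) \<le> C + D"
      by (intro bexI[OF _ zero_in_X_set[OF vM]]) simp
  qed
  from dist_qGH_le[OF L this] show ?thesis by (rule le_less_trans) simp
qed

section \<open>Symmetry of the distance\<close>

definition flip :: "('a \<times> 'b \<Rightarrow> real) \<Rightarrow> 'b \<times> 'a \<Rightarrow> real" where
  "flip L = (\<lambda>(y, x). L (x, y))"

lemma flip_Pair [simp]: "flip L (y, x) = L (x, y)"
  by (simp add: flip_def)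

lemma flip_admissible: "L \<in> admissible M LM N LN \<Longrightarrow> flip L \<in> admissible N LN M LM"
  by (rule admissibleI)
    (simp_all add: admissible_nonneg admissible_scale admissible_add admissible_left admissible_right)

text \<open>The distance puts the minus sign on the second component; multiplying the pair by -1
  moves it to the first, which makes the roles of \<open>M\<close> and \<open>N\<close>
  interchangeable.\<close>

lemma admissible_neg_swap:
  assumes "von_neumann_algebra N" "L \<in> admissible M LM N LN" "x \<in> M" "y \<in> N"
  shows "L (op_neg x, y) = L (x, op_neg y)"
  using admissible_neg[OF assms(2,3) vna_neg[OF assms(1,4)]] by simp

lemma flip_X_close:
  assumes v: "von_neumann_algebra N" and L: "L \<in> admissible M LM N LN" and c: "X_close L M N r"
  shows "X_close (flip L) N M r"
proof -
  have "flip L (B i j, op_neg (A i j)) = L (A i j, op_neg (B i j))"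
    if "A \<in> X_set M" "B \<in> X_set N" for A B i j
    using admissible_neg_swap[OF v L X_set_mem[OF that(1)] X_set_mem[OF that(2)]] by simp
  then show ?thesis using c unfolding X_close_def by metis
qed

lemma dist_qGH_commute_le:
  assumes "von_neumann_algebra N"
  shows "dist_qGH N LN M LM \<le> dist_qGH M LM N LN"
proof (rule ereal_le_of_real_bounds)
  fix r :: real assume "dist_qGH M LM N LN < ereal r"
  then obtain L where "L \<in> admissible M LM N LN" "X_close L M N r"
    by (rule dist_qGH_lessE)
  then show "dist_qGH N LN M LM \<le> ereal r"
    by (intro dist_qGH_le[of "flip L"] flip_admissible flip_X_close[OF assms])
qed

subsection \<open>The triangle inequality\<close>

text \<open>Infimal convolution. With \<open>L (x, op_neg y)\<close> read as the distance from
  \<open>x\<close> to \<open>y\<close>, the value at \<open>(x, op_neg z)\<close> is the shortest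
  way from \<open>x\<close> to \<open>z\<close> through \<open>N\<close>.\<close>

definition glue where
  "glue N L L' = (\<lambda>(x, z). INF y\<in>N. L (x, op_neg y) + L' (y, z) :: real)"

text \<open>On \<open>M\<close> the choice \<open>y = op_zero\<close> gives one inequality. For the
  other, \<open>L' (y, op_zero) = LN y = L (op_zero, y)\<close>, and adding
  \<open>(op_zero, y)\<close> to \<open>(x, op_neg y)\<close> returns \<open>(x, op_zero)\<close>;
  the argument on \<open>P\<close> is symmetric.\<close>

lemma glue_admissible:
  assumes vM: "von_neumann_algebra M" and LN: "LvNA N LN" and vP: "von_neumann_algebra P"
    and L: "L \<in> admissible M LM N LN" and L': "L' \<in> admissible N LN P LP"
  shows "glue N L L' \<in> admissible M LM P LP"
    and "\<And>x y z. x \<in> M \<Longrightarrow> y \<in> N \<Longrightarrow> z \<in> P \<Longrightarrow> glue N L L' (x, z) \<le> L (x, op_neg y) + L' (y, z)"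
proof -
  note vN = LvNA_vna[OF LN]
  have neN: "N \<noteq> {}" using vna_zero[OF vN] by blast
  have nonneg: "0 \<le> L (x, op_neg y) + L' (y, z)" if "x \<in> M" "y \<in> N" "z \<in> P" for x y z
    using admissible_nonneg[OF L that(1) vna_neg[OF vN that(2)]] admissible_nonneg[OF L' that(2,3)] by simp
  have bdd: "bdd_below ((\<lambda>y. L (x, op_neg y) + L' (y, z)) ` N)" if "x \<in> M" "z \<in> P" for x z
    using nonneg[OF that(1) _ that(2)] by (rule bdd_belowI2)
  show le: "glue N L L' (x, z) \<le> L (x, op_neg y) + L' (y, z)" if "x \<in> M" "y \<in> N" "z \<in> P" for x y z
    unfolding glue_def prod.case by (rule cINF_lower[OF bdd[OF that(1,3)] that(2)])
  have ge: "m \<le> glue N L L' (x, z)" if "\<And>y. y \<in> N \<Longrightarrow> m \<le> L (x, op_neg y) + L' (y, z)" for m x z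
    unfolding glue_def prod.case by (rule cINF_greatest[OF neN that])
  have near: "\<exists>y\<in>N. L (x, op_neg y) + L' (y, z) < glue N L L' (x, z) + e" if "e > 0" for x z and e :: real
  proof (rule ccontr)
    assume "\<not> ?thesis"
    then have "glue N L L' (x, z) + e \<le> glue N L L' (x, z)" by (intro ge) (auto simp: not_less)
    with that show False by simp
  qed
  have scale_le: "glue N L L' (op_scale c x, op_scale c z) \<le> cmod c * glue N L L' (x, z)"
    if x: "x \<in> M" and z: "z \<in> P" for c x z
  proof (rule field_le_epsilon)
    fix e :: real assume e: "e > 0"
    \<comment> \<open>The summand 1 in the denominator covers \<open>c = 0\<close>.\<close>
    have pos: "0 < e / (cmod c + 1)" by (rule divide_pos_pos[OF e]) (simp add: add_nonneg_pos)
    then obtain y where y: "y \<in> N" "L (x, op_neg y) + L' (y, z) < glue N L L' (x, z) + e / (cmod c + 1)"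
      using near by blast
    have "glue N L L' (op_scale c x, op_scale c z)
        \<le> L (op_scale c x, op_neg (op_scale c y)) + L' (op_scale c y, op_scale c z)"
      by (intro le vna_scale vM vN vP x y z)
    also have "\<dots> = cmod c * (L (x, op_neg y) + L' (y, z))"
      by (simp add: op_neg_scale admissible_scale[OF L x vna_neg[OF vN y(1)]]
          admissible_scale[OF L' y(1) z] distrib_left)
    also have "\<dots> \<le> cmod c * (glue N L L' (x, z) + e / (cmod c + 1))"
      using y(2) by (intro mult_left_mono) auto
    also have "\<dots> = cmod c * glue N L L' (x, z) + cmod c * (e / (cmod c + 1))"
      by (rule distrib_left)
    also have "cmod c * (e / (cmod c + 1)) \<le> (cmod c + 1) * (e / (cmod c + 1))"
      using pos by (intro mult_right_mono) auto
    also have "(cmod c + 1) * (e / (cmod c + 1)) = e"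
      using norm_ge_zero[of c] by (simp add: add_nonneg_eq_0_iff)
    finally show "glue N L L' (op_scale c x, op_scale c z) \<le> cmod c * glue N L L' (x, z) + e" by simp
  qed
  show "glue N L L' \<in> admissible M LM P LP"
  proof (rule admissibleI)
    fix x z x' z' and c :: complex
    assume x: "x \<in> M" and z: "z \<in> P"
    show nn: "0 \<le> glue N L L' (x, z)" by (rule ge) (rule nonneg[OF x _ z])
    show "glue N L L' (op_scale c x, op_scale c z) = cmod c * glue N L L' (x, z)"
    proof (cases "c = 0")
      case True
      have "0 \<le> glue N L L' (op_scale c x, op_scale c z)"
        by (rule ge) (intro nonneg vna_scale vM vP x z)
      then show ?thesis using scale_le[OF x z, of c] True by simp
    next
      case False
      have inv: "op_scale (inverse c) (op_scale c w) = w" for w :: "'x::chilbert \<Rightarrow> 'x"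
        using False by (simp add: op_scale_def hscale_hscale hscale_one)
      \<comment> \<open>The reverse inequality is \<open>scale_le\<close> for the inverse scalar at
        the scaled pair.\<close>
      have "glue N L L' (x, z) \<le> cmod (inverse c) * glue N L L' (op_scale c x, op_scale c z)"
        using scale_le[OF vna_scale[OF vM x] vna_scale[OF vP z], of "inverse c" c c] by (simp add: inv)
      then have "cmod c * glue N L L' (x, z) \<le> glue N L L' (op_scale c x, op_scale c z)"
        unfolding norm_inverse using False by (simp add: field_simps)
      then show ?thesis using scale_le[OF x z, of c] by simp
    qed
    assume x': "x' \<in> M" and z': "z' \<in> P"
    show "glue N L L' (op_add x x', op_add z z') \<le> glue N L L' (x, z) + glue N L L' (x', z')"
    proof (rule field_le_epsilon)
      fix e :: real assume "e > 0"
      then have e: "e / 2 > 0" by simp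
      obtain y where y: "y \<in> N" "L (x, op_neg y) + L' (y, z) < glue N L L' (x, z) + e / 2"
        using near[OF e] by blast
      obtain y' where y': "y' \<in> N" "L (x', op_neg y') + L' (y', z') < glue N L L' (x', z') + e / 2"
        using near[OF e] by blast
      have "glue N L L' (op_add x x', op_add z z')
          \<le> L (op_add x x', op_neg (op_add y y')) + L' (op_add y y', op_add z z')"
        by (intro le vna_add vM vN vP x y z x' y' z')
      moreover have "L (op_add x x', op_neg (op_add y y')) \<le> L (x, op_neg y) + L (x', op_neg y')"
        unfolding op_neg_add by (intro admissible_add[OF L] vna_neg vN x x' y y')
      moreover have "L' (op_add y y', op_add z z') \<le> L' (y, z) + L' (y', z')"
        by (intro admissible_add[OF L'] y y' z z')
      ultimately show "glue N L L' (op_add x x', op_add z z') \<le> glue N L L' (x, z) + glue N L L' (x', z') + e"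
        using y(2) y'(2) by simp
    qed
  next
    fix x assume x: "x \<in> M"
    have "glue N L L' (x, op_zero) \<le> L (x, op_neg op_zero) + L' (op_zero, op_zero)"
      by (intro le x vna_zero vN vP)
    also have "\<dots> = LM x"
      using admissible_left[OF L x] admissible_left[OF L' vna_zero[OF vN]] LvNA_eq_0[OF LN vna_zero[OF vN]] by simp
    finally have 1: "glue N L L' (x, op_zero) \<le> LM x" .
    have "LM x \<le> glue N L L' (x, op_zero)"
    proof (rule ge)
      fix y assume y: "y \<in> N"
      have "L (op_add x op_zero, op_add (op_neg y) y) \<le> L (x, op_neg y) + L (op_zero, y)"
        by (intro admissible_add[OF L] x y vna_neg vna_zero vN vM)
      then show "LM x \<le> L (x, op_neg y) + L' (y, op_zero)"
        using admissible_left[OF L x] admissible_right[OF L y] admissible_left[OF L' y] by simp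
    qed
    with 1 show "glue N L L' (x, op_zero) = LM x" by simp
  next
    fix z assume z: "z \<in> P"
    have "glue N L L' (op_zero, z) \<le> L (op_zero, op_neg op_zero) + L' (op_zero, z)"
      by (intro le z vna_zero vN vM)
    also have "\<dots> = LP z"
      using admissible_right[OF L' z] admissible_right[OF L vna_zero[OF vN]] LvNA_eq_0[OF LN vna_zero[OF vN]] by simp
    finally have 1: "glue N L L' (op_zero, z) \<le> LP z" .
    have "LP z \<le> glue N L L' (op_zero, z)"
    proof (rule ge)
      fix y assume y: "y \<in> N"
      have "L' (op_add (op_neg y) y, op_add op_zero z) \<le> L' (op_neg y, op_zero) + L' (y, z)"
        by (intro admissible_add[OF L'] z y vna_neg vna_zero vN vP)
      then show "LP z \<le> L (op_zero, op_neg y) + L' (y, z)"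
        using admissible_right[OF L' z] admissible_right[OF L vna_neg[OF vN y]]
          admissible_left[OF L' vna_neg[OF vN y]] by simp
    qed
    with 1 show "glue N L L' (op_zero, z) = LP z" by simp
  qed
qed

lemma glue_X_close:
  assumes vM: "von_neumann_algebra M" and LN: "LvNA N LN" and vP: "von_neumann_algebra P"
    and L: "L \<in> admissible M LM N LN" and L': "L' \<in> admissible N LN P LP"
    and c: "X_close L M N r" "X_close L' N P s"
  shows "X_close (glue N L L') M P (r + s)"
proof -
  have key: "\<forall>i j. glue N L L' (A i j, op_neg (C i j)) \<le> r + s"
    if "A \<in> X_set M" "B \<in> X_set N" "C \<in> X_set P"
      and "\<forall>i j. L (A i j, op_neg (B i j)) \<le> r" "\<forall>i j. L' (B i j, op_neg (C i j)) \<le> s" for A B C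
  proof (intro allI)
    fix i j
    have "glue N L L' (A i j, op_neg (C i j)) \<le> L (A i j, op_neg (B i j)) + L' (B i j, op_neg (C i j))"
      by (intro glue_admissible(2)[OF vM LN vP L L'] X_set_mem[OF that(1)] X_set_mem[OF that(2)]
          vna_neg[OF vP] X_set_mem[OF that(3)])
    also have "\<dots> \<le> r + s" using that(4,5) by (intro add_mono) auto
    finally show "glue N L L' (A i j, op_neg (C i j)) \<le> r + s" .
  qed
  show ?thesis unfolding X_close_def
  proof (intro conjI ballI)
    fix A assume A: "A \<in> X_set M"
    obtain B where B: "B \<in> X_set N" "\<forall>i j. L (A i j, op_neg (B i j)) \<le> r"
      using c(1) A unfolding X_close_def by blast
    obtain C where C: "C \<in> X_set P" "\<forall>i j. L' (B i j, op_neg (C i j)) \<le> s"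
      using c(2) B(1) unfolding X_close_def by blast
    show "\<exists>C\<in>X_set P. \<forall>i j. glue N L L' (A i j, op_neg (C i j)) \<le> r + s"
      using key[OF A B(1) C(1) B(2) C(2)] C(1) by blast
  next
    fix C assume C: "C \<in> X_set P"
    obtain B where B: "B \<in> X_set N" "\<forall>i j. L' (B i j, op_neg (C i j)) \<le> s"
      using c(2) C unfolding X_close_def by blast
    obtain A where A: "A \<in> X_set M" "\<forall>i j. L (A i j, op_neg (B i j)) \<le> r"
      using c(1) B(1) unfolding X_close_def by blast
    show "\<exists>A\<in>X_set M. \<forall>i j. glue N L L' (A i j, op_neg (C i j)) \<le> r + s"
      using key[OF A(1) B(1) C A(2) B(2)] A(1) by blast
  qed
qed

lemma dist_qGH_triangle:
  assumes LM: "LvNA M LM" and LN: "LvNA N LN" and LP: "LvNA P LP"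
  shows "dist_qGH M LM P LP \<le> dist_qGH M LM N LN + dist_qGH N LN P LP"
proof -
  note vM = LvNA_vna[OF LM] and vN = LvNA_vna[OF LN] and vP = LvNA_vna[OF LP]
  obtain a where a: "dist_qGH M LM N LN = ereal a"
    using dist_qGH_nonneg[OF vM vN, of LM LN] dist_qGH_finite[OF LM LN] by (cases "dist_qGH M LM N LN") auto
  obtain b where b: "dist_qGH N LN P LP = ereal b"
    using dist_qGH_nonneg[OF vN vP, of LN LP] dist_qGH_finite[OF LN LP] by (cases "dist_qGH N LN P LP") auto
  show ?thesis
  proof (rule ereal_le_of_real_bounds)
    fix t :: real assume "dist_qGH M LM N LN + dist_qGH N LN P LP < ereal t"
    then have t: "a + b < t" by (simp add: a b)
    \<comment> \<open>Both distances are real numbers, so the slack \<open>t - a - b\<close> can be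
      divided evenly between them.\<close>
    define r where "r = a + (t - a - b) / 2"
    define s where "s = b + (t - a - b) / 2"
    have rs: "r + s = t" "a < r" "b < s" using t by (auto simp: r_def s_def field_simps)
    obtain L where L: "L \<in> admissible M LM N LN" "X_close L M N r"
      using dist_qGH_lessE[of M LM N LN r] rs by (auto simp: a)
    obtain L' where L': "L' \<in> admissible N LN P LP" "X_close L' N P s"
      using dist_qGH_lessE[of N LN P LP s] rs by (auto simp: b)
    show "dist_qGH M LM P LP \<le> ereal t"
      using dist_qGH_le[OF glue_admissible(1)[OF vM LN vP L(1) L'(1)] glue_X_close[OF vM LN vP L(1) L'(1) L(2) L'(2)]]
      by (simp add: rs)
  qed
qed

subsection \<open>Distance zero\<close>

text \<open>The seminorm \<open>LN (op_add (\<phi> x) y)\<close> is admissible because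
  \<open>\<phi>\<close> is isometric, and it vanishes at \<open>(x, op_neg (\<phi> x))\<close>; a
  matrix and its entrywise image are then at distance zero.\<close>

lemma dist_qGH_zero_of_iso:
  assumes LM: "LvNA M LM" and LN: "LvNA N LN" and iso: "LvNA_iso M LM N LN"
  shows "dist_qGH M LM N LN = 0"
proof -
  note vM = LvNA_vna[OF LM] and vN = LvNA_vna[OF LN]
  obtain \<phi> where bij: "bij_betw \<phi> M N"
    and add: "\<And>x y. x \<in> M \<Longrightarrow> y \<in> M \<Longrightarrow> \<phi> (op_add x y) = op_add (\<phi> x) (\<phi> y)"
    and comp: "\<And>x y. x \<in> M \<Longrightarrow> y \<in> M \<Longrightarrow> \<phi> (x \<circ> y) = \<phi> x \<circ> \<phi> y"
    and scale: "\<And>c x. x \<in> M \<Longrightarrow> \<phi> (op_scale c x) = op_scale c (\<phi> x)"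
    and adj: "\<And>x. x \<in> M \<Longrightarrow> \<phi> (adj x) = adj (\<phi> x)"
    and isom: "\<And>x. x \<in> M \<Longrightarrow> LN (\<phi> x) = LM x"
    using iso unfolding LvNA_iso_def by blast
  define \<psi> where "\<psi> = inv_into M \<phi>"
  have mem: "\<phi> x \<in> N" if "x \<in> M" for x using bij that by (auto simp: bij_betw_def)
  have mem': "\<psi> y \<in> M" and pp: "\<phi> (\<psi> y) = y" if "y \<in> N" for y
    using bij that unfolding \<psi>_def bij_betw_def by (auto intro: inv_into_into f_inv_into_f)
  have inj: "x = x'" if "\<phi> x = \<phi> x'" "x \<in> M" "x' \<in> M" for x x'
    using bij that by (auto simp: bij_betw_def inj_on_def)
  \<comment> \<open>\<open>LvNA_iso\<close> does not list unitality. By surjectivity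
    \<open>id\<close> is an image, and \<open>\<phi> id\<close> acts as a left identity on
    images.\<close>
  have unit: "\<phi> id = id"
  proof -
    have "\<phi> id \<circ> \<phi> (\<psi> id) = \<phi> (id \<circ> \<psi> id)"
      by (rule comp[symmetric]) (intro vna_id[OF vM] mem' vna_id[OF vN])+
    then show ?thesis by (simp add: pp vna_id[OF vN])
  qed
  have zero: "\<phi> op_zero = op_zero"
    using scale[OF vna_id[OF vM], of 0] by (simp add: op_scale_def op_zero_def)
  have X: "(\<lambda>i j. \<phi> (A i j)) \<in> X_set N" if "A \<in> X_set M" for A
    by (rule star_hom_X_set[OF vM vN _ _ _ _ _ _ that]) (fact mem add comp scale adj unit)+
  have X': "(\<lambda>i j. \<psi> (B i j)) \<in> X_set M" if "B \<in> X_set N" for B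
  proof (rule star_hom_X_set[OF vN vM _ _ _ _ _ _ that])
    show "\<psi> (op_add x y) = op_add (\<psi> x) (\<psi> y)" if "x \<in> N" "y \<in> N" for x y
      by (rule inj) (simp_all add: that pp add mem' vna_add[OF vN] vna_add[OF vM])
    show "\<psi> (x \<circ> y) = \<psi> x \<circ> \<psi> y" if "x \<in> N" "y \<in> N" for x y
      by (rule inj) (simp_all add: that pp comp mem' vna_comp[OF vN] vna_comp[OF vM])
    show "\<psi> (op_scale c x) = op_scale c (\<psi> x)" if "x \<in> N" for c x
      by (rule inj) (simp_all add: that pp scale mem' vna_scale[OF vN] vna_scale[OF vM])
    show "\<psi> (adj x) = adj (\<psi> x)" if "x \<in> N" for x
      by (rule inj) (simp_all add: that pp adj mem' vna_adj[OF vN] vna_adj[OF vM])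
    show "\<psi> id = id"
      by (rule inj) (simp_all add: pp unit mem' vna_id[OF vN] vna_id[OF vM])
  qed (rule mem')
  define L where "L = (\<lambda>(x, y). LN (op_add (\<phi> x) y))"
  have L: "L \<in> admissible M LM N LN"
  proof (rule admissibleI)
    fix x y x' y' and c :: complex assume m: "x \<in> M" "y \<in> N"
    show "0 \<le> L (x, y)" by (simp add: L_def LvNA_nonneg[OF LN] vna_add[OF vN] mem m)
    have "op_add (op_scale c (\<phi> x)) (op_scale c y) = op_scale c (op_add (\<phi> x) y)"
      by (simp add: op_add_def op_scale_def hscale_add_right)
    then show "L (op_scale c x, op_scale c y) = cmod c * L (x, y)"
      by (simp add: L_def scale m LvNA_scale[OF LN] vna_add[OF vN] mem)
    assume m': "x' \<in> M" "y' \<in> N"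
    have "op_add (op_add (\<phi> x) (\<phi> x')) (op_add y y') = op_add (op_add (\<phi> x) y) (op_add (\<phi> x') y')"
      by (simp add: op_add_def add_ac)
    then show "L (op_add x x', op_add y y') \<le> L (x, y) + L (x', y')"
      by (simp add: L_def add m m' LvNA_add[OF LN] vna_add[OF vN] mem)
  qed (simp_all add: L_def isom zero)
  have z: "L (x, op_neg (\<phi> x)) = 0" if "x \<in> M" for x
    using LvNA_eq_0[OF LN vna_zero[OF vN]] by (simp add: L_def)
  have z': "L (\<psi> y, op_neg y) = 0" if "y \<in> N" for y
    using z[OF mem'[OF that]] by (simp add: pp that)
  have "X_close L M N 0" unfolding X_close_def
  proof (intro conjI ballI)
    fix A assume A: "A \<in> X_set M"
    show "\<exists>B\<in>X_set N. \<forall>i j. L (A i j, op_neg (B i j)) \<le> 0"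
      by (rule bexI[OF _ X[OF A]]) (simp add: z X_set_mem[OF A])
  next
    fix B assume B: "B \<in> X_set N"
    show "\<exists>A\<in>X_set M. \<forall>i j. L (A i j, op_neg (B i j)) \<le> 0"
      by (rule bexI[OF _ X'[OF B]]) (simp add: z' X_set_mem[OF B])
  qed
  from dist_qGH_le[OF L this] dist_qGH_nonneg[OF vM vN] show ?thesis
    by (simp add: zero_ereal_def antisym)
qed

section \<open>From distance zero to an isomorphism\<close>

lemma positive_op_weak_limit:
  assumes u: "ultra U" and l: "weak_limit U T S" and p: "\<And>n. positive_op (T n)"
  shows "positive_op S"
  unfolding positive_op_def
proof (intro allI conjI)
  fix v
  have nb: "U \<noteq> bot" using u by (simp add: ultra_def)
  have lim: "((\<lambda>n. cinner v (T n v)) \<longlongrightarrow> cinner v (S v)) U" using l by (simp add: weak_limit_def)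
  have "((\<lambda>n. Im (cinner v (T n v))) \<longlongrightarrow> Im (cinner v (S v))) U" by (intro tendsto_Im lim)
  then have "((\<lambda>n. 0) \<longlongrightarrow> Im (cinner v (S v))) U" using p by (simp add: positive_op_def)
  then show "Im (cinner v (S v)) = 0" using tendsto_unique[OF nb] tendsto_const by blast
  have "((\<lambda>n. Re (cinner v (T n v))) \<longlongrightarrow> Re (cinner v (S v))) U" by (intro tendsto_Re lim)
  then show "0 \<le> Re (cinner v (S v))"
    by (rule tendsto_lowerbound) (use p nb in \<open>auto simp: positive_op_def\<close>)
qed

lemma weak_limit_op_diff_id:
  assumes "weak_limit U T S" shows "weak_limit U (\<lambda>n. op_diff id (T n)) (op_diff id S)"
  unfolding weak_limit_def op_diff_def cinner_diff_right
  by (intro allI tendsto_diff tendsto_const) (use assms in \<open>simp add: weak_limit_def\<close>)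

definition limit_rel where
  "limit_rel M N U L x y \<longleftrightarrow> x \<in> M \<and> y \<in> N \<and> ((\<lambda>n. L n (x, op_neg y) :: real) \<longlongrightarrow> 0) U"

text \<open>Linearity and uniqueness follow by squeezing. For \<open>R_X\<close>, the approximate
  partners of \<open>A\<close> have an entrywise weak ultralimit, which stays in
  \<open>X_set N\<close> because positivity of a matrix and of its difference from the identity are
  weakly closed.\<close>

lemma limit_rel_X_relation:
  assumes LM: "LvNA M LM" and LN: "LvNA N LN" and u: "ultra U" "U \<le> sequentially"
    and L: "\<And>n. L n \<in> admissible M LM N LN"
    and c: "\<And>n. X_close (L n) M N (inverse (real (Suc n)))"
  shows "X_relation M N (limit_rel M N U L)"
proof
  show vM: "von_neumann_algebra M" and vN: "von_neumann_algebra N"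
    using LM LN LvNA_vna by blast+
  have nb: "U \<noteq> bot" using u(1) by (simp add: ultra_def)
  have squeeze: "((\<lambda>n. L n (x, op_neg y)) \<longlongrightarrow> 0) U"
    if "x \<in> M" "y \<in> N" "\<And>n. L n (x, op_neg y) \<le> f n" "(f \<longlongrightarrow> 0) U" for x y f
  proof (rule Lim_null_comparison[OF always_eventually that(4)], rule allI)
    fix n show "norm (L n (x, op_neg y)) \<le> f n"
      using that(3)[of n] admissible_nonneg[OF L that(1) vna_neg[OF vN that(2)], of n] by simp
  qed
  show "x \<in> M \<and> y \<in> N" if "limit_rel M N U L x y" for x y
    using that by (simp add: limit_rel_def)
  show "limit_rel M N U L (op_add x x') (op_add y y')"
    if R: "limit_rel M N U L x y" "limit_rel M N U L x' y'" for x y x' y'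
  proof -
    have m: "x \<in> M" "y \<in> N" "x' \<in> M" "y' \<in> N" using R by (auto simp: limit_rel_def)
    have "((\<lambda>n. L n (x, op_neg y) + L n (x', op_neg y')) \<longlongrightarrow> 0 + 0) U"
      using R by (intro tendsto_add) (auto simp: limit_rel_def)
    moreover have "L n (op_add x x', op_neg (op_add y y')) \<le> L n (x, op_neg y) + L n (x', op_neg y')" for n
      unfolding op_neg_add by (intro admissible_add[OF L] m vna_neg vN)
    ultimately show ?thesis unfolding limit_rel_def
      using squeeze[OF vna_add[OF vM m(1,3)] vna_add[OF vN m(2,4)],
          of "\<lambda>n. L n (x, op_neg y) + L n (x', op_neg y')"]
      by (simp add: vna_add[OF vM] vna_add[OF vN] m)
  qed
  show "limit_rel M N U L (op_scale k x) (op_scale k y)" if R: "limit_rel M N U L x y" for k x y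
  proof -
    have m: "x \<in> M" "y \<in> N" using R by (auto simp: limit_rel_def)
    have "((\<lambda>n. cmod k * L n (x, op_neg y)) \<longlongrightarrow> cmod k * 0) U"
      using R by (intro tendsto_mult_left) (auto simp: limit_rel_def)
    then show ?thesis
      by (simp add: limit_rel_def m vna_scale[OF vM] vna_scale[OF vN] op_neg_scale
          admissible_scale[OF L m(1) vna_neg[OF vN m(2)]])
  qed
  show "y = y'" if R: "limit_rel M N U L x y" "limit_rel M N U L x y'" for x y y'
  proof -
    have m: "x \<in> M" "y \<in> N" "y' \<in> N" using R by (auto simp: limit_rel_def)
    \<comment> \<open>\<open>LN ?d\<close> does not depend on \<open>n\<close> and is bounded by a
      quantity that tends to zero along \<open>U\<close>.\<close>
    let ?d = "op_add (op_neg y) y'"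
    have dN: "?d \<in> N" by (intro vna_add vna_neg vN m)
    have "LN ?d \<le> L n (x, op_neg y) + L n (x, op_neg y')" for n
    proof -
      have "L n (op_add x (op_neg x), ?d) \<le> L n (x, op_neg y) + L n (op_neg x, y')"
        by (intro admissible_add[OF L] m vna_neg vN vM)
      then show ?thesis
        by (simp add: admissible_right[OF L dN] admissible_neg_swap[OF vN L m(1,3)])
    qed
    moreover have "((\<lambda>n. L n (x, op_neg y) + L n (x, op_neg y')) \<longlongrightarrow> 0 + 0) U"
      using R by (intro tendsto_add) (auto simp: limit_rel_def)
    ultimately have "LN ?d \<le> 0" using tendsto_lowerbound[OF _ always_eventually nb] by fastforce
    then have "?d = op_zero" using LvNA_nonneg[OF LN dN] LvNA_eq_0[OF LN dN] by simp
    then show ?thesis by (simp add: op_add_def op_neg_def op_zero_def fun_eq_iff)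
  qed
  show "\<exists>G\<in>X_set N. \<forall>i j. limit_rel M N U L (A i j) (G i j)" if A: "A \<in> X_set M" for A
  proof -
    have "\<forall>n. \<exists>B. B \<in> X_set N \<and> (\<forall>i j. L n (A i j, op_neg (B i j)) \<le> inverse (real (Suc n)))"
      using c A unfolding X_close_def by blast
    then obtain B where B: "\<And>n. B n \<in> X_set N"
      and close: "\<And>n i j. L n (A i j, op_neg (B n i j)) \<le> inverse (real (Suc n))" by metis
    have BN: "B n i j \<in> N" for n i j by (rule X_set_mem[OF B])
    have Ble: "hnorm (B n i j v) \<le> 1 * hnorm v" for n i j v using X_set_entry_le[OF vN B] by simp
    have ex: "\<exists>S. S \<in> N \<and> (\<forall>v. hnorm (S v) \<le> 1 * hnorm v) \<and> weak_limit U (\<lambda>n. B n i j) S" for i j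
      by (rule weak_limit_exists[OF u(1) vna_bounded_op[OF vN BN] Ble zero_le_one])
        (intro exI conjI allI vna_weak_limit[OF vN u(1) BN])
    define G where "G i j = (SOME S. S \<in> N \<and> (\<forall>v. hnorm (S v) \<le> 1 * hnorm v) \<and> weak_limit U (\<lambda>n. B n i j) S)" for i j
    have G: "G i j \<in> N" "\<And>v. hnorm (G i j v) \<le> 1 * hnorm v" "weak_limit U (\<lambda>n. B n i j) (G i j)" for i j
      using someI_ex[OF ex] unfolding G_def by blast+
    have wl: "weak_limit U (\<lambda>n. mat_op (B n)) (mat_op G)"
      by (rule mat_op_weak_limit) (rule G(3))
    have "positive_op (mat_op G)"
      by (rule positive_op_weak_limit[OF u(1) wl]) (use B X_set_iff[OF vN] in blast)
    moreover have "positive_op (op_diff id (mat_op G))"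
      by (rule positive_op_weak_limit[OF u(1) weak_limit_op_diff_id[OF wl]]) (use B X_set_iff[OF vN] in blast)
    ultimately have GX: "G \<in> X_set N" using G(1) X_set_iff[OF vN] by blast
    have "limit_rel M N U L (A i j) (G i j)" for i j
    proof -
      have AM: "A i j \<in> M" by (rule X_set_mem[OF A])
      \<comment> \<open>Replacing \<open>B n\<close> by \<open>G\<close> costs \<open>LN\<close> of
        their difference, which vanishes along \<open>U\<close> by
        \<open>LvNA_weak_limit\<close>.\<close>
      have "L n (A i j, op_neg (G i j)) \<le> inverse (real (Suc n)) + LN (op_diff (B n i j) (G i j))" for n
      proof -
        have dN: "op_diff (B n i j) (G i j) \<in> N" by (intro vna_diff vN BN G)
        have "L n (op_add (A i j) op_zero, op_add (op_neg (B n i j)) (op_diff (B n i j) (G i j)))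
            \<le> L n (A i j, op_neg (B n i j)) + L n (op_zero, op_diff (B n i j) (G i j))"
          by (intro admissible_add[OF L] AM dN vna_neg vN BN vna_zero vM)
        moreover have "op_add (op_neg (B n i j)) (op_diff (B n i j) (G i j)) = op_neg (G i j)"
          by (simp add: op_add_def op_neg_def op_diff_def)
        ultimately show ?thesis using close[of n i j] by (simp add: admissible_right[OF L dN])
      qed
      moreover have "((\<lambda>n. inverse (real (Suc n)) + LN (op_diff (B n i j) (G i j))) \<longlongrightarrow> 0 + 0) U"
        by (intro tendsto_add tendsto_mono[OF u(2) LIMSEQ_inverse_real_of_nat]
            LvNA_weak_limit[OF LN u(1) BN Ble G(1,2) zero_le_one G(3)])
      ultimately show ?thesis unfolding limit_rel_def using squeeze[OF AM G(1)[of i j],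
          of "\<lambda>n. inverse (real (Suc n)) + LN (op_diff (B n i j) (G i j))"] AM G(1) by simp
    qed
    then show ?thesis using GX by blast
  qed
qed

lemma iso_of_dist_qGH_zero:
  assumes LM: "LvNA M LM" and LN: "LvNA N LN" and zero: "dist_qGH M LM N LN = 0"
  shows "LvNA_iso M LM N LN"
proof -
  note vM = LvNA_vna[OF LM] and vN = LvNA_vna[OF LN]
  have "\<exists>L. L \<in> admissible M LM N LN \<and> X_close L M N (inverse (real (Suc n)))" for n
  proof -
    have "dist_qGH M LM N LN < ereal (inverse (real (Suc n)))" by (simp add: zero)
    then show ?thesis by (rule dist_qGH_lessE) blast
  qed
  then obtain L where L: "\<And>n. L n \<in> admissible M LM N LN"
    and c: "\<And>n. X_close (L n) M N (inverse (real (Suc n)))" by metis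
  obtain U where u: "ultra U" "U \<le> sequentially" by (rule ultra_exists)
  have nb: "U \<noteq> bot" using u(1) by (simp add: ultra_def)
  \<comment> \<open>The same construction for the flipped seminorms yields exactly the converse
    relation, so one lemma supplies both halves of \<open>X_birelation\<close>.\<close>
  have "X_relation N M (limit_rel N M U (\<lambda>n. flip (L n)))"
    by (rule limit_rel_X_relation[OF LN LM u]) (intro flip_admissible L flip_X_close[OF vN L c])+
  moreover have "limit_rel N M U (\<lambda>n. flip (L n)) = (\<lambda>y x. limit_rel M N U L x y)"
  proof (intro ext)
    fix y x
    have "flip (L n) (y, op_neg x) = L n (x, op_neg y)" if "x \<in> M" "y \<in> N" for n
      using admissible_neg_swap[OF vN L that] by simp
    then show "limit_rel N M U (\<lambda>n. flip (L n)) y x = limit_rel M N U L x y"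
      unfolding limit_rel_def by (auto simp del: flip_Pair)
  qed
  ultimately interpret X_birelation M N "limit_rel M N U L"
    using limit_rel_X_relation[OF LM LN u L c] by (simp add: X_birelation_def)
  show ?thesis
  proof (rule LvNA_isoI)
    fix x y assume R: "limit_rel M N U L x y"
    then have m: "x \<in> M" "y \<in> N" and lim: "((\<lambda>n. L n (x, op_neg y)) \<longlongrightarrow> 0) U"
      by (auto simp: limit_rel_def)
    \<comment> \<open>Two triangle inequalities, one in each direction; the left side is constant
      while the right side tends to zero.\<close>
    have "\<bar>LN y - LM x\<bar> \<le> L n (x, op_neg y)" for n
    proof -
      have "L n (op_add x op_zero, op_add (op_neg y) y) \<le> L n (x, op_neg y) + L n (op_zero, y)"
        by (intro admissible_add[OF L] m vna_neg vna_zero vN vM)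
      moreover have "L n (op_add (op_neg x) x, op_add y op_zero) \<le> L n (op_neg x, y) + L n (x, op_zero)"
        by (intro admissible_add[OF L] m vna_neg vna_zero vN vM)
      ultimately show ?thesis
        using admissible_neg_swap[OF vN L m, of n]
        by (simp add: admissible_left[OF L m(1)] admissible_right[OF L m(2)])
    qed
    then have "\<bar>LN y - LM x\<bar> \<le> 0"
      by (intro tendsto_lowerbound[OF lim always_eventually nb]) simp
    then show "LN y = LM x" by simp
  qed
qed

text \<open>Invariance under isomorphism is included: isomorphic algebras have distance zero, so by
  the triangle inequality replacing an algebra by an isomorphic copy, possibly on another Hilbert
  space, leaves all distances unchanged.\<close>

theorem mainTheorem10:
  fixes M :: "('a::chilbert \<Rightarrow> 'a) set" and LM :: "('a \<Rightarrow> 'a) \<Rightarrow> real"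
    and N :: "('b::chilbert \<Rightarrow> 'b) set" and LN :: "('b \<Rightarrow> 'b) \<Rightarrow> real"
    and P :: "('c::chilbert \<Rightarrow> 'c) set" and LP :: "('c \<Rightarrow> 'c) \<Rightarrow> real"
  assumes "LvNA M LM" and "LvNA N LN" and "LvNA P LP"
  shows "0 \<le> dist_qGH M LM N LN \<and> dist_qGH M LM N LN < \<infinity> \<and>
         dist_qGH M LM N LN = dist_qGH N LN M LM \<and>
         dist_qGH M LM P LP \<le> dist_qGH M LM N LN + dist_qGH N LN P LP \<and>
         (dist_qGH M LM N LN = 0 \<longleftrightarrow> LvNA_iso M LM N LN)"
  using dist_qGH_nonneg dist_qGH_finite dist_qGH_triangle dist_qGH_zero_of_iso iso_of_dist_qGH_zero
    dist_qGH_commute_le LvNA_vna assms by (metis antisym)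

end
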